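(* Let $I\subset\mathbb{R}$ be an open interval, let $\gamma:I\to\mathbb{R}^2$ be a $C^\infty$ regular plane curve (that is, $\gamma'(r)\neq 0$ for all $r\in I$), and let $r_0\in I$ be such that the curvature of $\gamma$ at $p=\gamma(r_0)$ is nonzero. For $r\in I$ let $T_r$ denote the tangent line to $\gamma$ at $\gamma(r)$, and for $r\neq s$ in $I$ close to $r_0$ let $\Psi(r,s)$ denote the intersection point of $T_r$ and $T_s$. Then there is an open neighborhood $W\subset I\times I$ of $(r_0,r_0)$ such that for every open neighborhood $N\subset W$ of $(r_0,r_0)$ for which $N\setminus\{(r,r): r\in I\}$ has exactly the two connected components $N\cap\{r<s\}$ and $N\cap\{r>s\}$, and for $C$ either one of these two components, the local tangent Lagrangian $2$-web on $\Psi(C)\subset(\mathbb{R}^2,dx\wedge dy)$ does not satisfy the Samuelson condition.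
   Context: Lagrangian $2$-web: on an open set $M\subset\mathbb{R}^2$ with symplectic form $\omega=dx\wedge dy$, a Lagrangian $2$-web is an ordered pair $(\mathcal F_1,\mathcal F_2)$ of smooth codimension-one foliations of $M$ (automatically Lagrangian, as leaves are curves) whose leaves are transverse to each other. Locally it is given by the level curves of two smooth functions (first integrals) $u,v$ with $du\wedge dv\neq 0$. Samuelson condition: the web on $M$ satisfies the Samuelson condition if every point of $M$ has an open neighborhood $V\subset M$, with first integrals $u,v$ of $\mathcal F_1,\mathcal F_2$ on $V$ such that $(u,v)$ is a diffeomorphism of $V$ onto an open rectangle $K\times L$, for which the following holds. For all $u_0<u_1<u_2$ in $K$ and $v_0<v_1<v_2$ in $L$, let $a_{ij}$ ($i,j\in\{1,2\}$) be the Euclidean area of the quadrilateral $\{q\in V: u_{i-1}<u(q)<u_i,\ v_{j-1}<v(q)<v_j\}$; then $a_{11}/a_{12}=a_{21}/a_{22}$. (Thus, for four adjacent small quadrilaterals cut out by three leaves of each foliation, the ratio of areas of the two in one strip equals the corresponding ratio in the neighboring strip.) Local tangent Lagrangian $2$-web: for $C$ a component as in the claim, with $N$ sufficiently small, the lines $T_r,T_s$ with $(r,s)\in C$ are not parallel and $\Psi$ is a diffeomorphism from $C$ onto the open set $\Psi(C)$. The two foliations of the web on $\Psi(C)$ have as first integrals the two components $r$ and $s$ of $\Psi^{-1}$, so their leaves are (locally) pieces of the tangent lines $T_r$ and of the tangent lines $T_s$, respectively. *)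

theory Defs
  imports "HOL-Analysis.Analysis"
begin

section \<open>Smooth maps on open sets\<close>

text \<open>On an open subset of a Euclidean space, membership in C^k amounts to differentiability with
  all directional derivatives in C^(k-1).\<close>

primrec C_k_on :: "nat \<Rightarrow> 'a::euclidean_space set \<Rightarrow> ('a \<Rightarrow> 'b::euclidean_space) \<Rightarrow> bool" where
  "C_k_on 0 S f \<longleftrightarrow> continuous_on S f"
| "C_k_on (Suc k) S f \<longleftrightarrow>
     (\<forall>x\<in>S. f differentiable (at x)) \<and> (\<forall>v. C_k_on k S (\<lambda>x. frechet_derivative f (at x) v))"

definition smooth_on :: "'a::euclidean_space set \<Rightarrow> ('a \<Rightarrow> 'b::euclidean_space) \<Rightarrow> bool" where
  "smooth_on S f \<longleftrightarrow> open S \<and> (\<forall>k. C_k_on k S f)"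

definition diffeomorphism_between ::
  "'a::euclidean_space set \<Rightarrow> 'b::euclidean_space set \<Rightarrow> ('a \<Rightarrow> 'b) \<Rightarrow> bool" where
  "diffeomorphism_between S T f \<longleftrightarrow>
     bij_betw f S T \<and> smooth_on S f \<and> smooth_on T (the_inv_into S f)"


section \<open>Foliations and Lagrangian 2-webs in the plane\<close>

type_synonym plane = "real \<times> real"

text \<open>The symplectic form dx \<and> dy.\<close>

definition omega :: "plane \<Rightarrow> plane \<Rightarrow> real" where
  "omega a b = fst a * snd b - snd a * fst b"

text \<open>The coefficient of du \<and> dv with respect to dx \<and> dy.\<close>

definition wedge_d :: "(plane \<Rightarrow> real) \<Rightarrow> (plane \<Rightarrow> real) \<Rightarrow> plane \<Rightarrow> real" where
  "wedge_d u v q =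
     frechet_derivative u (at q) (1, 0) * frechet_derivative v (at q) (0, 1) -
     frechet_derivative u (at q) (0, 1) * frechet_derivative v (at q) (1, 0)"

definition level_curves :: "plane set \<Rightarrow> (plane \<Rightarrow> real) \<Rightarrow> plane set set" where
  "level_curves V u = (\<Union>c. components {q \<in> V. u q = c})"

text \<open>A foliation is represented by its set of leaves. A leaf may return to \<open>V\<close> many times, and two
  plaques of \<open>V\<close> in the same leaf may lie on different levels of a first integral; this is why
  components of \<open>L \<inter> V\<close> are compared with components of level sets.\<close>

definition first_integral :: "plane set set \<Rightarrow> plane set \<Rightarrow> (plane \<Rightarrow> real) \<Rightarrow> bool" where
  "first_integral F V u \<longleftrightarrow>
     smooth_on V u \<and> (\<forall>q\<in>V. frechet_derivative u (at q) \<noteq> (\<lambda>_. 0)) \<and>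
     (\<Union>L\<in>F. components (L \<inter> V)) = level_curves V u"

text \<open>Path-connectedness of the leaves, as opposed to connectedness, excludes glueing a leaf to
  another one that accumulates on it.\<close>

definition foliation :: "plane set \<Rightarrow> plane set set \<Rightarrow> bool" where
  "foliation M F \<longleftrightarrow>
     open M \<and> partition_on M F \<and> (\<forall>L\<in>F. path_connected L) \<and>
     (\<forall>p\<in>M. \<exists>V u. open V \<and> p \<in> V \<and> V \<subseteq> M \<and> first_integral F V u)"

type_synonym web = "plane set set \<times> plane set set"

text \<open>Leaves are curves, so they are Lagrangian for every area form and no condition is needed to
  express this.\<close>

definition lagrangian_2_web :: "plane set \<Rightarrow> web \<Rightarrow> bool" where
  "lagrangian_2_web M \<F> \<longleftrightarrow>
     foliation M (fst \<F>) \<and> foliation M (snd \<F>) \<and>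
     (\<forall>p\<in>M. \<exists>V u v. open V \<and> p \<in> V \<and> V \<subseteq> M \<and>
        first_integral (fst \<F>) V u \<and> first_integral (snd \<F>) V v \<and>
        (\<forall>q\<in>V. wedge_d u v q \<noteq> 0))"


section \<open>The Samuelson condition\<close>

definition quad_area ::
  "plane set \<Rightarrow> (plane \<Rightarrow> real) \<Rightarrow> (plane \<Rightarrow> real) \<Rightarrow> real \<Rightarrow> real \<Rightarrow> real \<Rightarrow> real \<Rightarrow> real" where
  "quad_area V u v a b c d = measure lborel {q \<in> V. a < u q \<and> u q < b \<and> c < v q \<and> v q < d}"

text \<open>The open intervals \<open>K\<close> and \<open>L\<close> may be unbounded. The quadrilaterals still have compact closure
  in \<open>V\<close>, hence finite and positive area.\<close>

definition samuelson :: "plane set \<Rightarrow> web \<Rightarrow> bool" where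
  "samuelson M \<F> \<longleftrightarrow>
     (\<forall>p\<in>M. \<exists>V u v K L.
        open V \<and> p \<in> V \<and> V \<subseteq> M \<and>
        first_integral (fst \<F>) V u \<and> first_integral (snd \<F>) V v \<and>
        open K \<and> is_interval K \<and> open L \<and> is_interval L \<and>
        diffeomorphism_between V (K \<times> L) (\<lambda>q. (u q, v q)) \<and>
        (\<forall>u0\<in>K. \<forall>u1\<in>K. \<forall>u2\<in>K. \<forall>v0\<in>L. \<forall>v1\<in>L. \<forall>v2\<in>L.
           u0 < u1 \<and> u1 < u2 \<and> v0 < v1 \<and> v1 < v2 \<longrightarrow>
           quad_area V u v u0 u1 v0 v1 / quad_area V u v u0 u1 v1 v2 =
           quad_area V u v u1 u2 v0 v1 / quad_area V u v u1 u2 v1 v2))"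


section \<open>Plane curves and the tangent web\<close>

definition velocity :: "(real \<Rightarrow> plane) \<Rightarrow> real \<Rightarrow> plane" where
  "velocity \<gamma> r = vector_derivative \<gamma> (at r)"

definition curvature :: "(real \<Rightarrow> plane) \<Rightarrow> real \<Rightarrow> real" where
  "curvature \<gamma> r =
     omega (velocity \<gamma> r) (vector_derivative (velocity \<gamma>) (at r)) / norm (velocity \<gamma> r) ^ 3"

definition tangent_line :: "(real \<Rightarrow> plane) \<Rightarrow> real \<Rightarrow> plane set" where
  "tangent_line \<gamma> r = range (\<lambda>t. \<gamma> r + t *\<^sub>R velocity \<gamma> r)"

definition parallel_tangents :: "(real \<Rightarrow> plane) \<Rightarrow> real \<Rightarrow> real \<Rightarrow> bool" where
  "parallel_tangents \<gamma> r s \<longleftrightarrow> omega (velocity \<gamma> r) (velocity \<gamma> s) = 0"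

text \<open>Meaningful only when the two tangent lines are not parallel.\<close>

definition tangent_intersection :: "(real \<Rightarrow> plane) \<Rightarrow> real \<times> real \<Rightarrow> plane" where
  "tangent_intersection \<gamma> = (\<lambda>(r, s). THE q. q \<in> tangent_line \<gamma> r \<inter> tangent_line \<gamma> s)"

definition tangent_web :: "(real \<Rightarrow> plane) \<Rightarrow> (real \<times> real) set \<Rightarrow> web" where
  "tangent_web \<gamma> C =
     (let M = tangent_intersection \<gamma> ` C; \<Phi> = the_inv_into C (tangent_intersection \<gamma>)
      in (level_curves M (\<lambda>q. fst (\<Phi> q)), level_curves M (\<lambda>q. snd (\<Phi> q))))"

end

theory Submission
  imports Defs
begin

text \<open>
  If two tangents \<open>T\<^sub>r\<close>, \<open>T\<^sub>s\<close> meet at \<open>\<gamma> r + t \<gamma>' r = \<gamma> s + t' \<gamma>' s\<close>, then in the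
  coordinates \<open>(r, s)\<close> the area form has the density \<open>\<bar>t t' \<omega>(\<gamma>' r, \<gamma>'' r) \<omega>(\<gamma>' s, \<gamma>'' s) / \<omega>(\<gamma>' r, \<gamma>' s)\<bar>\<close>,
  which near the diagonal is asymptotic to a constant multiple of \<open>\<bar>s - r\<bar>\<close>. The first integrals in the
  Samuelson condition are functions of \<open>r\<close> and of \<open>s\<close>, respectively; shrinking the quadrilaterals shows
  that the density \<open>D\<close> satisfies \<open>D(r, s) D(r', s') = D(r, s') D(r', s)\<close> locally, and hence on every
  rectangle. This fails for \<open>r, r' = r\<^sub>0 - 2h, r\<^sub>0 - h\<close> and \<open>s, s' = r\<^sub>0 + h, r\<^sub>0 + 2h\<close>, where the two
  sides are close to multiples by \<open>3 * 3\<close> and \<open>4 * 2\<close> of the same number.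
\<close>

text \<open>In the Jacobian of \<open>\<Psi>\<close> the curvature factors
  \<open>bend \<gamma> r r\<close> and \<open>bend \<gamma> s s\<close> depend on one coordinate
  each, so they cancel in the exchange identity; only the coupling of \<open>r\<close> with
  \<open>s\<close> can violate it. Mean value theorems determine this coupling up to a factor within
  1 percent of 1, and no finer expansion is made. Such an estimate detects nothing on a rectangle
  that is small compared with its distance to the diagonal, whereas the Samuelson condition provides
  rectangles of uncontrolled size around each point. Hence the passage from local rectangles to all
  rectangles in \<open>C\<close>, through the logarithm of the density, before the test on a
  rectangle whose size is comparable to its distance from the diagonal. There the estimate is
  decisive because \<open>9 * 0.99^2 > 8 * 1.01^2\<close>.\<close>

section \<open>Calculus of smooth maps\<close>

lemma C_k_on_cong:
  assumes "open S" "\<And>x. x \<in> S \<Longrightarrow> f x = g x"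
  shows "C_k_on k S f \<longleftrightarrow> C_k_on k S g"
proof -
  have *: "C_k_on k S g" if "\<And>x. x \<in> S \<Longrightarrow> f x = g x" "C_k_on k S f" for f g
    using that
  proof (induction k arbitrary: f g)
    case 0
    then show ?case by (simp cong: continuous_on_cong)
  next
    case (Suc k)
    have der: "(g has_derivative frechet_derivative f (at x)) (at x)" if "x \<in> S" for x
    proof (rule has_derivative_transform_within_open[OF _ \<open>open S\<close> that])
      show "(f has_derivative frechet_derivative f (at x)) (at x)"
        using Suc.prems(2) that frechet_derivative_works by auto
    qed (use Suc.prems(1) in auto)
    have "C_k_on k S (\<lambda>x. frechet_derivative g (at x) v)" for v
    proof (rule Suc.IH)
      show "C_k_on k S (\<lambda>x. frechet_derivative f (at x) v)"
        using Suc.prems(2) by simp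
      show "frechet_derivative f (at x) v = frechet_derivative g (at x) v" if "x \<in> S" for x
        using frechet_derivative_at[OF der[OF that]] by simp
    qed
    then show ?case
      using der by (auto simp: differentiable_def)
  qed
  show ?thesis
    using *[of f g] *[of g f] assms(2) by auto
qed

text \<open>Lets an explicit derivative replace the choice made by
  \<open>frechet_derivative\<close>; most closure lemmas below are inductions on \<open>k\<close>
  with this rule as the step.\<close>

lemma C_k_on_SucI:
  assumes "open S" "\<And>x. x \<in> S \<Longrightarrow> (f has_derivative f' x) (at x)"
    and "\<And>v. C_k_on k S (\<lambda>x. f' x v)"
  shows "C_k_on (Suc k) S f"
proof -
  have "C_k_on k S (\<lambda>x. frechet_derivative f (at x) v) \<longleftrightarrow> C_k_on k S (\<lambda>x. f' x v)" for v
    using assms(2)[THEN frechet_derivative_at] by (intro C_k_on_cong[OF assms(1)]) auto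
  then show ?thesis
    using assms by (auto simp: differentiable_def)
qed

lemma C_k_on_SucD:
  assumes "C_k_on (Suc k) S f"
  shows "\<And>x. x \<in> S \<Longrightarrow> (f has_derivative frechet_derivative f (at x)) (at x)"
    and "\<And>v. C_k_on k S (\<lambda>x. frechet_derivative f (at x) v)"
  using assms frechet_derivative_works by auto

lemma C_k_on_Suc_imp: "C_k_on (Suc k) S f \<Longrightarrow> C_k_on k S f"
proof (induction k arbitrary: f)
  case 0
  then show ?case
    by (auto intro!: continuous_at_imp_continuous_on differentiable_imp_continuous_within)
next
  case (Suc k)
  then show ?case
    by (metis C_k_on.simps(2))
qed

lemma C_k_on_const: "open S \<Longrightarrow> C_k_on k S (\<lambda>x. c)"
proof (induction k arbitrary: c)
  case (Suc k)
  then show ?case by (intro C_k_on_SucI[where f'="\<lambda>x v. 0"]) auto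
qed auto

lemma C_k_on_ident: "open S \<Longrightarrow> C_k_on k S (\<lambda>x. x)"
proof (cases k)
  case (Suc l)
  then show "open S \<Longrightarrow> ?thesis"
    by (auto intro!: C_k_on_SucI[where f'="\<lambda>x v. v"] C_k_on_const simp del: C_k_on.simps)
qed auto

lemma C_k_on_linear:
  assumes "open S" "bounded_linear h"
  shows "C_k_on k S f \<Longrightarrow> C_k_on k S (\<lambda>x. h (f x))"
proof (induction k arbitrary: f)
  case 0
  then show ?case
    using assms(2) by (auto intro: bounded_linear.continuous_on)
next
  case (Suc k)
  note D = C_k_on_SucD[OF Suc.prems]
  show ?case
    by (rule C_k_on_SucI[OF assms(1) bounded_linear.has_derivative[OF assms(2) D(1)]])
      (auto intro: Suc.IH D(2))
qed

lemma C_k_on_add: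
  assumes "open S"
  shows "C_k_on k S f \<Longrightarrow> C_k_on k S g \<Longrightarrow> C_k_on k S (\<lambda>x. f x + g x)"
proof (induction k arbitrary: f g)
  case 0
  then show ?case
    by (auto intro: continuous_intros)
next
  case (Suc k)
  note D = C_k_on_SucD[OF Suc.prems(1)] C_k_on_SucD[OF Suc.prems(2)]
  show ?case
    by (rule C_k_on_SucI[OF assms(1) has_derivative_add[OF D(1) D(3)]])
      (auto intro: Suc.IH D)
qed

lemma C_k_on_sum:
  assumes "open S" "\<And>i. i \<in> A \<Longrightarrow> C_k_on k S (f i)"
  shows "C_k_on k S (\<lambda>x. \<Sum>i\<in>A. f i x)"
  using assms(2)
  by (induction A rule: infinite_finite_induct) (auto intro: C_k_on_const C_k_on_add assms(1))

text \<open>Stated for an arbitrary bounded bilinear map, so that products, scalar multiples and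
  \<open>omega\<close> are covered at once. The product rule pairs each function with a derivative
  of the other, which is why both are also used at the lower order \<open>k\<close>.\<close>

lemma C_k_on_bilinear:
  assumes "open S" "bounded_bilinear h"
  shows "C_k_on k S f \<Longrightarrow> C_k_on k S g \<Longrightarrow> C_k_on k S (\<lambda>x. h (f x) (g x))"
proof (induction k arbitrary: f g)
  case 0
  then show ?case
    using assms(2) by (auto intro: bounded_bilinear.continuous_on)
next
  case (Suc k)
  note D = C_k_on_SucD[OF Suc.prems(1)] C_k_on_SucD[OF Suc.prems(2)]
  show ?case
    by (rule C_k_on_SucI[OF assms(1) bounded_bilinear.FDERIV[OF assms(2) D(1) D(3)]])
      (auto intro!: Suc.IH C_k_on_add[OF assms(1)] D Suc.prems[THEN C_k_on_Suc_imp])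
qed

lemma C_k_on_inverse:
  fixes f :: "'a::euclidean_space \<Rightarrow> real"
  assumes "open S" "\<And>x. x \<in> S \<Longrightarrow> f x \<noteq> 0"
  shows "C_k_on k S f \<Longrightarrow> C_k_on k S (\<lambda>x. inverse (f x))"
proof (induction k)
  case 0
  then show ?case
    using assms(2) by (auto intro: continuous_intros)
next
  case (Suc k)
  note D = C_k_on_SucD[OF Suc.prems]
  \<comment> \<open>The derivative of the reciprocal contains the reciprocal itself, which has class
    \<open>k\<close> by induction.\<close>
  note I = Suc.IH[OF C_k_on_Suc_imp[OF Suc.prems]]
  show ?case
  proof (rule C_k_on_SucI[OF assms(1)])
    show "((\<lambda>x. inverse (f x)) has_derivative
        (\<lambda>v. - (inverse (f x) * frechet_derivative f (at x) v * inverse (f x)))) (at x)" if "x \<in> S" for x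
      using Deriv.has_derivative_inverse[OF assms(2)[OF that] D(1)[OF that]] .
    show "C_k_on k S (\<lambda>x. - (inverse (f x) * frechet_derivative f (at x) v * inverse (f x)))" for v
      by (intro C_k_on_linear[OF assms(1) bounded_linear_minus[OF bounded_linear_ident]]
            C_k_on_bilinear[OF assms(1) bounded_bilinear_mult] I D)
  qed
qed

lemma C_k_on_compose:
  fixes g :: "'b::euclidean_space \<Rightarrow> 'c::euclidean_space"
  assumes "open S" "f ` S \<subseteq> T"
  shows "C_k_on k T g \<Longrightarrow> C_k_on k S f \<Longrightarrow> C_k_on k S (\<lambda>x. g (f x))"
  using assms(2)
proof (induction k arbitrary: g)
  case 0
  then show ?case
    by (auto intro: continuous_on_compose2)
next
  case (Suc k)
  note D = C_k_on_SucD[OF Suc.prems(1)] C_k_on_SucD[OF Suc.prems(2)]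
  show ?case
  proof (rule C_k_on_SucI[OF assms(1)])
    \<comment> \<open>The chain rule evaluates the derivative of \<open>g\<close> in a direction
      that varies with \<open>x\<close>, while \<open>C_k_on\<close> controls fixed directions only.
      Expanding that direction in the basis separates the two dependences.\<close>
    show "((\<lambda>x. g (f x)) has_derivative
        (\<lambda>v. \<Sum>b\<in>Basis. (frechet_derivative f (at x) v \<bullet> b) *\<^sub>R frechet_derivative g (at (f x)) b)) (at x)"
      if "x \<in> S" for x
    proof -
      have fx: "f x \<in> T"
        using that assms(2) by auto
      interpret g: bounded_linear "frechet_derivative g (at (f x))"
        using D(1)[OF fx] has_derivative_bounded_linear by blast
      have "frechet_derivative g (at (f x)) w = (\<Sum>b\<in>Basis. (w \<bullet> b) *\<^sub>R frechet_derivative g (at (f x)) b)" for w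
        by (subst euclidean_representation[of w, symmetric]) (simp only: g.sum g.scaleR)
      then have "(\<lambda>v. frechet_derivative g (at (f x)) (frechet_derivative f (at x) v)) =
          (\<lambda>v. \<Sum>b\<in>Basis. (frechet_derivative f (at x) v \<bullet> b) *\<^sub>R frechet_derivative g (at (f x)) b)"
        by fast
      then show ?thesis
        using has_derivative_compose[OF D(3)[OF that] D(1)[OF fx]] by metis
    qed
    show "C_k_on k S (\<lambda>x. \<Sum>b\<in>Basis. (frechet_derivative f (at x) v \<bullet> b) *\<^sub>R frechet_derivative g (at (f x)) b)" for v
      by (intro C_k_on_sum[OF assms(1)] C_k_on_bilinear[OF assms(1) bounded_bilinear_scaleR]
            C_k_on_linear[OF assms(1) bounded_linear_inner_left] D
            Suc.IH[OF D(2) C_k_on_Suc_imp[OF Suc.prems(2)] assms(2)])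
  qed
qed

section \<open>Closure properties for smoothness of all orders\<close>

lemma smooth_onD:
  assumes "smooth_on S f"
  shows "open S" "C_k_on k S f" "continuous_on S f"
    and "\<And>x. x \<in> S \<Longrightarrow> (f has_derivative frechet_derivative f (at x)) (at x)"
    and "smooth_on S (\<lambda>x. frechet_derivative f (at x) v)"
proof -
  have *: "C_k_on l S f" for l
    using assms by (auto simp: smooth_on_def)
  show "open S" "C_k_on k S f"
    using assms by (auto simp: smooth_on_def)
  show "continuous_on S f"
    using *[of 0] by simp
  show "\<And>x. x \<in> S \<Longrightarrow> (f has_derivative frechet_derivative f (at x)) (at x)"
    using C_k_on_SucD(1)[OF *[of "Suc 0"]] .
  show "smooth_on S (\<lambda>x. frechet_derivative f (at x) v)"
    using C_k_on_SucD(2)[OF *[of "Suc _"]] assms by (auto simp: smooth_on_def)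
qed

lemma smooth_on_subset: "smooth_on S f \<Longrightarrow> open T \<Longrightarrow> T \<subseteq> S \<Longrightarrow> smooth_on T f"
proof -
  assume "smooth_on S f" "open T" "T \<subseteq> S"
  moreover have "C_k_on k T g" if "C_k_on k S g" "T \<subseteq> S" for k and g :: "'a \<Rightarrow> 'b"
    using that
  proof (induction k arbitrary: g)
    case 0
    then show ?case by (auto intro: continuous_on_subset)
  qed auto
  ultimately show ?thesis by (auto simp: smooth_on_def)
qed

lemma smooth_on_cong:
  assumes "smooth_on S f" "\<And>x. x \<in> S \<Longrightarrow> g x = f x"
  shows "smooth_on S g"
  using assms C_k_on_cong[of S g f] by (auto simp: smooth_on_def)

lemma smooth_on_const: "open S \<Longrightarrow> smooth_on S (\<lambda>x. c)"
  and smooth_on_ident: "open S \<Longrightarrow> smooth_on S (\<lambda>x. x)"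
  by (auto simp: smooth_on_def intro: C_k_on_const C_k_on_ident)

lemma smooth_on_linear: "bounded_linear h \<Longrightarrow> smooth_on S f \<Longrightarrow> smooth_on S (\<lambda>x. h (f x))"
  and smooth_on_add: "smooth_on S f \<Longrightarrow> smooth_on S f2 \<Longrightarrow> smooth_on S (\<lambda>x. f x + f2 x)"
  and smooth_on_bilinear: "bounded_bilinear h2 \<Longrightarrow> smooth_on S f \<Longrightarrow> smooth_on S f' \<Longrightarrow>
    smooth_on S (\<lambda>x. h2 (f x) (f' x))"
  by (auto simp: smooth_on_def intro: C_k_on_linear C_k_on_add C_k_on_bilinear)

lemma smooth_on_minus: "smooth_on S f \<Longrightarrow> smooth_on S (\<lambda>x. - f x)"
  by (rule smooth_on_linear[OF bounded_linear_minus[OF bounded_linear_ident]])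

lemma smooth_on_diff: "smooth_on S f \<Longrightarrow> smooth_on S g \<Longrightarrow> smooth_on S (\<lambda>x. f x - g x)"
  using smooth_on_add[OF _ smooth_on_minus, of S f g] by simp

lemma smooth_on_compose:
  "smooth_on T g \<Longrightarrow> smooth_on S f \<Longrightarrow> f ` S \<subseteq> T \<Longrightarrow> smooth_on S (\<lambda>x. g (f x))"
  unfolding smooth_on_def using C_k_on_compose by blast

lemma smooth_on_fst: "open S \<Longrightarrow> smooth_on S fst"
  and smooth_on_snd: "open S \<Longrightarrow> smooth_on S snd"
  using smooth_on_linear[OF bounded_linear_fst smooth_on_ident]
    smooth_on_linear[OF bounded_linear_snd smooth_on_ident] by auto

lemma C_k_on_Pair: 
  assumes "open S" "C_k_on k S f" "C_k_on k S g"
  shows "C_k_on k S (\<lambda>x. (f x, g x))"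
proof -
  have "bounded_linear (\<lambda>x. (x, 0))" "bounded_linear (\<lambda>x. (0, x))"
    by (auto intro: bounded_linear_Pair bounded_linear_ident bounded_linear_zero)
  from this[THEN C_k_on_linear[OF assms(1)]] assms
  have "C_k_on k S (\<lambda>x. (f x, 0) + (0, g x))"
    by (intro C_k_on_add) auto
  then show ?thesis by simp
qed

lemma smooth_on_divide:
  fixes f :: "'a::euclidean_space \<Rightarrow> real"
  assumes "smooth_on S f" "smooth_on S g" "\<And>x. x \<in> S \<Longrightarrow> g x \<noteq> 0"
  shows "smooth_on S (\<lambda>x. f x / g x)"
  unfolding divide_inverse
  using assms C_k_on_inverse[of S g] smooth_on_bilinear[OF bounded_bilinear_mult, of S f "\<lambda>x. inverse (g x)"]
  by (auto simp: smooth_on_def)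

lemma smooth_on_Pair: "smooth_on S f \<Longrightarrow> smooth_on S g \<Longrightarrow> smooth_on S (\<lambda>x. (f x, g x))"
  by (auto simp: smooth_on_def intro: C_k_on_Pair)

lemmas smooth_on_mult = smooth_on_bilinear[OF bounded_bilinear_mult]
  and smooth_on_scaleR = smooth_on_bilinear[OF bounded_bilinear_scaleR]

text \<open>A bootstrapping argument, used in place of a smooth inverse function theorem.\<close>

lemma smooth_on_autonomous:
  assumes "open M" "f ` M \<subseteq> C" "\<And>q. q \<in> M \<Longrightarrow> (f has_derivative (\<lambda>z. G z (f q))) (at q)"
    and "\<And>z. smooth_on C (G z)"
  shows "smooth_on M f"
proof -
  have "C_k_on k M f" for k
  proof (induction k)
    case 0
    then show ?case
      using assms(3) by (auto intro!: continuous_at_imp_continuous_on has_derivative_continuous)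
  next
    case (Suc k)
    show ?case
      by (rule C_k_on_SucI[OF assms(1,3)]) (auto intro: C_k_on_compose[OF assms(1,2) _ Suc] smooth_onD assms(4))
  qed
  then show ?thesis
    using assms(1) by (auto simp: smooth_on_def)
qed

section \<open>Intersections of tangents\<close>

lemma bounded_bilinear_omega: "bounded_bilinear omega"
proof -
  have "bounded_bilinear (\<lambda>a b :: plane. fst a * snd b - snd a * fst b)"
    unfolding bilinear_conv_bounded_bilinear[symmetric] bilinear_def
    by (auto intro!: linearI simp: algebra_simps)
  then show ?thesis
    by (simp add: omega_def[abs_def])
qed

interpretation omega: bounded_bilinear omega
  by (rule bounded_bilinear_omega)

lemma omega_self [simp]: "omega a a = 0"
  and omega_commute: "omega a b = - omega b a"
  by (simp_all add: omega_def)

text \<open>Nondegeneracy of \<open>omega\<close>, by which vector identities are checked through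
  pairings with two independent velocities.\<close>

lemma omega_eqI:
  assumes "omega a b \<noteq> 0" "omega x a = omega y a" "omega x b = omega y b"
  shows "x = y"
proof -
  define d where "d = x - y"
  have "omega d a = 0" "omega d b = 0"
    using assms by (auto simp: d_def omega.diff_left)
  then have "fst d * omega a b = 0" "snd d * omega a b = 0"
    unfolding omega_def by algebra+
  then have "d = 0"
    using assms(1) by (simp add: prod_eq_iff)
  then show ?thesis by (simp add: d_def)
qed

text \<open>The endpoints come in either order, so that both sides of the diagonal are served. That
  \<open>c\<close> avoids the endpoints matters in \<open>gap_eq\<close>, where a factor
  \<open>c - s\<close> is cancelled.\<close>

lemma Cauchy_mean_value_interval:
  fixes f g :: "real \<Rightarrow> real"
  assumes "is_interval J" "x \<in> J" "y \<in> J" "x \<noteq> y"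
    and f: "\<And>z. z \<in> J \<Longrightarrow> (f has_field_derivative f' z) (at z)"
    and g: "\<And>z. z \<in> J \<Longrightarrow> (g has_field_derivative g' z) (at z)"
  shows "\<exists>c\<in>J. c \<noteq> x \<and> c \<noteq> y \<and> (f y - f x) * g' c = (g y - g x) * f' c"
proof -
  have *: "\<exists>c\<in>J. c \<noteq> a \<and> c \<noteq> b \<and> (f b - f a) * g' c = (g b - g a) * f' c"
    if "a \<in> J" "b \<in> J" "a < b" for a b
  proof -
    have J: "z \<in> J" if "a \<le> z" "z \<le> b" for z
      using mem_is_interval_1_I[OF assms(1) \<open>a \<in> J\<close> \<open>b \<in> J\<close> that] .
    have "\<exists>c>a. c < b \<and> (f b - f a) * g' c = (g b - g a) * f' c"
      using J f g by (intro GMVT'[OF \<open>a < b\<close>]) (auto intro: DERIV_isCont)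
    then show ?thesis
      using J by (metis less_imp_le less_irrefl)
  qed
  show ?thesis
  proof (cases "x < y")
    case False
    then obtain c where "c \<in> J" "c \<noteq> x" "c \<noteq> y" "(f x - f y) * g' c = (g x - g y) * f' c"
      using *[of y x] assms by auto
    then show ?thesis
      by (intro bexI[of _ c]) (auto simp: algebra_simps)
  qed (use * assms in auto)
qed

section \<open>Relative position of two tangents, measured by \<open>omega\<close>\<close>

abbreviation accel :: "(real \<Rightarrow> plane) \<Rightarrow> real \<Rightarrow> plane" where
  "accel \<gamma> r \<equiv> vector_derivative (velocity \<gamma>) (at r)"

definition turn :: "(real \<Rightarrow> plane) \<Rightarrow> real \<Rightarrow> real \<Rightarrow> real" where
  "turn \<gamma> r s = omega (velocity \<gamma> r) (velocity \<gamma> s)"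

text \<open>Up to sign, the numerator in Cramer's rule for the meeting point of two tangents;
  \<open>turn\<close> is the determinant.\<close>

definition gap :: "(real \<Rightarrow> plane) \<Rightarrow> real \<Rightarrow> real \<Rightarrow> real" where
  "gap \<gamma> r s = omega (\<gamma> r - \<gamma> s) (velocity \<gamma> s)"

text \<open>On the diagonal this is the numerator of the curvature. Two arguments are needed because
  the mean value theorems evaluate velocity and acceleration at different parameters.\<close>

definition bend :: "(real \<Rightarrow> plane) \<Rightarrow> real \<Rightarrow> real \<Rightarrow> real" where
  "bend \<gamma> r s = omega (velocity \<gamma> r) (accel \<gamma> s)"

text \<open>The tangents \<open>T\<^sub>r\<close> and \<open>T\<^sub>s\<close> meet at \<open>\<gamma> r + offset \<gamma> r s *\<^sub>R velocity \<gamma> r\<close>.\<close>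

definition offset :: "(real \<Rightarrow> plane) \<Rightarrow> real \<Rightarrow> real \<Rightarrow> real" where
  "offset \<gamma> r s = - gap \<gamma> r s / turn \<gamma> r s"

lemma turn_commute: "turn \<gamma> r s = - turn \<gamma> s r"
  by (simp add: turn_def omega_def)

lemma smooth_on_velocity:
  assumes "smooth_on J \<gamma>"
  shows "r \<in> J \<Longrightarrow> (\<gamma> has_vector_derivative velocity \<gamma> r) (at r)"
    and "smooth_on J (velocity \<gamma>)"
proof -
  note D = smooth_onD(4)[OF assms]
  show *: "(\<gamma> has_vector_derivative velocity \<gamma> r) (at r)" if "r \<in> J" for r
    unfolding velocity_def using D[OF that] differentiableI vector_derivative_works by blast
  show "smooth_on J (velocity \<gamma>)"
  proof (rule smooth_on_cong[OF smooth_onD(5)[OF assms]])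
    show "velocity \<gamma> r = frechet_derivative \<gamma> (at r) 1" if "r \<in> J" for r
      using *[OF that] frechet_derivative_at unfolding has_vector_derivative_def
      by (metis scaleR_one)
  qed
qed

lemma has_real_derivative_omega:
  assumes "(f has_vector_derivative f') (at x)" "(g has_vector_derivative g') (at x)"
  shows "((\<lambda>x. omega (f x) (g x)) has_field_derivative omega (f x) g' + omega f' (g x)) (at x)"
  using omega.has_vector_derivative[OF assms]
  by (simp add: has_real_derivative_iff_has_vector_derivative)

text \<open>The reference value \<open>\<kappa>\<close> will be \<open>bend \<gamma> r0 r0\<close>.
  The tolerance 1/1000 is small enough for the five perturbed factors in \<open>density_eq\<close>
  to stay together within 1 percent.\<close>

locale convex_arc =
  fixes \<gamma> :: "real \<Rightarrow> plane" and J :: "real set" and \<kappa> :: real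
  assumes open_J: "open J" and interval_J: "is_interval J" and smooth_\<gamma>: "smooth_on J \<gamma>"
    and bend_near: "r \<in> J \<Longrightarrow> s \<in> J \<Longrightarrow> \<bar>bend \<gamma> r s / \<kappa> - 1\<bar> < 1 / 1000"
begin

lemma bend_bounds:
  assumes "r \<in> J" "s \<in> J"
  shows "\<kappa> \<noteq> 0" "999 / 1000 < bend \<gamma> r s / \<kappa>" "bend \<gamma> r s / \<kappa> < 1001 / 1000" "bend \<gamma> r s \<noteq> 0"
proof -
  show *: "999 / 1000 < bend \<gamma> r s / \<kappa>" "bend \<gamma> r s / \<kappa> < 1001 / 1000"
    using bend_near[OF assms] unfolding abs_less_iff by linarith+
  \<comment> \<open>Division by zero yields 0, so a vanishing \<open>\<kappa>\<close> or
    \<open>bend\<close> would contradict the lower bound.\<close>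
  show "\<kappa> \<noteq> 0" "bend \<gamma> r s \<noteq> 0"
    using *(1) by auto
qed

lemmas \<gamma>_deriv = smooth_on_velocity(1)[OF smooth_\<gamma>]
  and smooth_velocity = smooth_on_velocity(2)[OF smooth_\<gamma>]

lemma velocity_deriv: "r \<in> J \<Longrightarrow> (velocity \<gamma> has_vector_derivative accel \<gamma> r) (at r)"
  using smooth_on_velocity(1)[OF smooth_velocity] by (simp add: velocity_def)

lemma smooth_accel: "smooth_on J (accel \<gamma>)"
  using smooth_on_velocity(2)[OF smooth_velocity] by (simp add: velocity_def[abs_def])

text \<open>Mean value theorem in the second argument, starting from
  \<open>turn \<gamma> r r = 0\<close>.\<close>

lemma turn_eq:
  assumes "r \<in> J" "s \<in> J"
  obtains c where "c \<in> J" "turn \<gamma> r s = (s - r) * bend \<gamma> r c"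
proof (cases "r = s")
  case True
  then show ?thesis using that[of r] assms by (simp add: turn_def)
next
  case False
  have "((\<lambda>x. turn \<gamma> r x) has_field_derivative bend \<gamma> r z) (at z)" if "z \<in> J" for z
    unfolding turn_def bend_def
    using has_real_derivative_omega[OF has_vector_derivative_const velocity_deriv[OF that]]
    by (simp add: omega.zero_left)
  from Cauchy_mean_value_interval[OF interval_J assms False this DERIV_ident]
  obtain c where "c \<in> J" "(turn \<gamma> r s - turn \<gamma> r r) * 1 = (s - r) * bend \<gamma> r c"
    by auto
  then show ?thesis using that[of c] by (simp add: turn_def)
qed

text \<open>A second order Taylor formula in mean value form: the derivative of \<open>gap\<close>
  in its first argument is \<open>turn\<close>, so Cauchy's theorem against
  \<open>(x - s)\<^sup>2\<close>, followed by \<open>turn_eq\<close>, leaves a single value of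
  \<open>bend\<close>.\<close>

lemma gap_eq:
  assumes "r \<in> J" "s \<in> J"
  obtains a b where "a \<in> J" "b \<in> J" "gap \<gamma> r s = - ((s - r)\<^sup>2 / 2 * bend \<gamma> a b)"
proof (cases "r = s")
  case True
  then show ?thesis using that[of r r] assms by (simp add: gap_def omega.zero_left)
next
  case False
  have 1: "((\<lambda>x. gap \<gamma> x s) has_field_derivative turn \<gamma> z s) (at z)" if "z \<in> J" for z
  proof -
    have "((\<lambda>x. \<gamma> x - \<gamma> s) has_vector_derivative velocity \<gamma> z - 0) (at z)"
      by (intro has_vector_derivative_diff \<gamma>_deriv[OF that] has_vector_derivative_const)
    from has_real_derivative_omega[OF this has_vector_derivative_const[of "velocity \<gamma> s"]]
    show ?thesis
      by (simp add: turn_def gap_def omega.zero_right)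
  qed
  have 2: "((\<lambda>x. (x - s)\<^sup>2) has_field_derivative 2 * (z - s)) (at z)" for z
    by (auto intro!: derivative_eq_intros)
  from Cauchy_mean_value_interval[OF interval_J assms False 1 2]
  obtain c where c: "c \<in> J" "c \<noteq> s" "(gap \<gamma> s s - gap \<gamma> r s) * (2 * (c - s)) = ((s - s)\<^sup>2 - (r - s)\<^sup>2) * turn \<gamma> c s"
    by blast
  obtain b where b: "b \<in> J" "turn \<gamma> c s = (s - c) * bend \<gamma> c b"
    using turn_eq[OF c(1) assms(2)] .
  have "(c - s) * (2 * gap \<gamma> r s + (r - s)\<^sup>2 * bend \<gamma> c b) = 0"
    using c(3) unfolding b(2) by (simp add: gap_def omega.zero_left algebra_simps)
  then have "gap \<gamma> r s = - ((s - r)\<^sup>2 / 2 * bend \<gamma> c b)"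
    using c(2) by (simp add: power2_commute)
  then show ?thesis using that c b by blast
qed

lemma turn_nonzero: "r \<in> J \<Longrightarrow> s \<in> J \<Longrightarrow> r \<noteq> s \<Longrightarrow> turn \<gamma> r s \<noteq> 0"
  using turn_eq[of r s] bend_bounds(4) by (metis mult_eq_0_iff right_minus_eq)

text \<open>The quotient is half a ratio of two values of \<open>bend\<close>, both of the sign of
  \<open>\<kappa>\<close>. Geometrically, the meeting point lies ahead of \<open>\<gamma> r\<close>
  on its tangent if \<open>r < s\<close> and behind it if \<open>s < r\<close>.\<close>

lemma offset_sign:
  assumes "r \<in> J" "s \<in> J" "r \<noteq> s"
  shows "0 < offset \<gamma> r s / (s - r)"
proof -
  obtain c where c: "c \<in> J" "turn \<gamma> r s = (s - r) * bend \<gamma> r c"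
    using turn_eq[OF assms(1,2)] .
  obtain a b where ab: "a \<in> J" "b \<in> J" "gap \<gamma> r s = - ((s - r)\<^sup>2 / 2 * bend \<gamma> a b)"
    using gap_eq[OF assms(1,2)] .
  have "offset \<gamma> r s / (s - r) = (bend \<gamma> a b / \<kappa>) / (2 * (bend \<gamma> r c / \<kappa>))"
  proof -
    define d where "d = s - r"
    have "d \<noteq> 0"
      using assms(3) by (simp add: d_def)
    then show ?thesis
      using bend_bounds(1,4)[OF assms(1) c(1)]
      unfolding offset_def c ab d_def[symmetric] by (simp add: field_simps power2_eq_square)
  qed
  moreover have "0 < bend \<gamma> a b / \<kappa>" "0 < bend \<gamma> r c / \<kappa>"
    using bend_bounds(2)[OF ab(1,2)] bend_bounds(2)[OF assms(1) c(1)] by linarith+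
  ultimately show ?thesis by (metis zero_less_divide_iff zero_less_mult_iff zero_less_numeral)
qed

lemma offset_nonzero: "r \<in> J \<Longrightarrow> s \<in> J \<Longrightarrow> r \<noteq> s \<Longrightarrow> offset \<gamma> r s \<noteq> 0"
  using offset_sign by fastforce

section \<open>Existence and uniqueness of meeting points\<close>

abbreviation "\<Psi> \<equiv> tangent_intersection \<gamma>"

text \<open>The offsets solve the linear system by Cramer's rule: the difference of the two points
  pairs to zero with both velocities, which are independent.\<close>

lemma tangent_lines_meet:
  assumes "r \<in> J" "s \<in> J" "r \<noteq> s"
  shows "\<gamma> r + offset \<gamma> r s *\<^sub>R velocity \<gamma> r = \<gamma> s + offset \<gamma> s r *\<^sub>R velocity \<gamma> s"
    (is "?x = ?y")
proof -
  note w = turn_nonzero[OF assms]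
  have "omega (?x - ?y) (velocity \<gamma> r) = 0"
  proof -
    have "omega (?x - ?y) (velocity \<gamma> r) = - gap \<gamma> s r - offset \<gamma> s r * turn \<gamma> s r"
      by (simp add: gap_def turn_def omega.add_left omega.diff_left omega.scaleR_left)
    then show ?thesis
      using w turn_commute[of \<gamma> r s] by (simp add: offset_def)
  qed
  moreover have "omega (?x - ?y) (velocity \<gamma> s) = 0"
  proof -
    have "omega (?x - ?y) (velocity \<gamma> s) = gap \<gamma> r s + offset \<gamma> r s * turn \<gamma> r s"
      by (simp add: gap_def turn_def omega.add_left omega.diff_left omega.scaleR_left)
    then show ?thesis
      using w by (simp add: offset_def)
  qed
  ultimately have "?x - ?y = 0"
    using w unfolding turn_def by (intro omega_eqI[of "velocity \<gamma> r" "velocity \<gamma> s"]) (auto simp: omega.zero_left)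
  then show ?thesis by simp
qed

lemma tangent_line_inter:
  assumes "r \<in> J" "s \<in> J" "r \<noteq> s"
  shows "tangent_line \<gamma> r \<inter> tangent_line \<gamma> s = {\<gamma> r + offset \<gamma> r s *\<^sub>R velocity \<gamma> r}"
proof -
  have "t = offset \<gamma> r s" if "\<gamma> r + t *\<^sub>R velocity \<gamma> r = \<gamma> s + t' *\<^sub>R velocity \<gamma> s" for t t'
  proof -
    have "\<gamma> r - \<gamma> s + t *\<^sub>R velocity \<gamma> r = t' *\<^sub>R velocity \<gamma> s"
      using that by (simp add: algebra_simps)
    then have "gap \<gamma> r s + t * turn \<gamma> r s = 0"
      unfolding gap_def turn_def
      by (metis omega.add_left omega.scaleR_left omega_self real_scaleR_def scaleR_zero_right)
    then show ?thesis
      using turn_nonzero[OF assms] by (simp add: offset_def field_simps add_eq_0_iff)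
  qed
  then have "tangent_line \<gamma> r \<inter> tangent_line \<gamma> s \<subseteq> {\<gamma> r + offset \<gamma> r s *\<^sub>R velocity \<gamma> r}"
    unfolding tangent_line_def by blast
  moreover have "\<gamma> r + offset \<gamma> r s *\<^sub>R velocity \<gamma> r \<in> tangent_line \<gamma> s"
    unfolding tangent_lines_meet[OF assms] tangent_line_def by blast
  ultimately show ?thesis
    unfolding tangent_line_def by blast
qed

lemma tangent_intersection_eq:
  assumes "r \<in> J" "s \<in> J" "r \<noteq> s"
  shows "\<Psi> (r, s) = \<gamma> r + offset \<gamma> r s *\<^sub>R velocity \<gamma> r"
    and "\<Psi> (r, s) = \<gamma> s + offset \<gamma> s r *\<^sub>R velocity \<gamma> s"
proof -
  show "\<Psi> (r, s) = \<gamma> r + offset \<gamma> r s *\<^sub>R velocity \<gamma> r"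
    by (simp only: tangent_intersection_def case_prod_conv tangent_line_inter[OF assms] singleton_iff the_eq_trivial)
  then show "\<Psi> (r, s) = \<gamma> s + offset \<gamma> s r *\<^sub>R velocity \<gamma> s"
    by (simp only: tangent_lines_meet[OF assms])
qed

text \<open>The point of tangency of the middle one of three concurrent tangents would lie both before and
  after the common point.\<close>

lemma no_three_concurrent_tangents:
  assumes "{a, b, c} \<subseteq> J" "a < b" "b < c"
    and q: "q \<in> tangent_line \<gamma> a" "q \<in> tangent_line \<gamma> b" "q \<in> tangent_line \<gamma> c"
  shows False
proof -
  have abc: "a \<in> J" "b \<in> J" "c \<in> J" "b \<noteq> a" "b \<noteq> c"
    using assms by auto
  have "q = \<gamma> b + offset \<gamma> b a *\<^sub>R velocity \<gamma> b" "q = \<gamma> b + offset \<gamma> b c *\<^sub>R velocity \<gamma> b"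
    using q tangent_line_inter[OF abc(2,1,4)] tangent_line_inter[OF abc(2,3,5)] by auto
  moreover have "velocity \<gamma> b \<noteq> 0"
    using bend_bounds(4)[OF abc(2,2)] by (auto simp: bend_def omega.zero_left)
  ultimately have "offset \<gamma> b a = offset \<gamma> b c"
    by auto
  then show False
    using offset_sign[OF abc(2,1,4)] offset_sign[OF abc(2,3,5)] assms(2,3)
    by (simp add: zero_less_divide_iff)
qed

lemma at_most_two_tangents:
  assumes "{a, b, c} \<subseteq> J" "q \<in> tangent_line \<gamma> a" "q \<in> tangent_line \<gamma> b" "q \<in> tangent_line \<gamma> c"
  shows "a = b \<or> b = c \<or> a = c"
proof (rule ccontr)
  assume "\<not> ?thesis"
  then consider "a < b" "b < c" | "a < c" "c < b" | "b < a" "a < c" | "b < c" "c < a" 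
    | "c < a" "a < b" | "c < b" "b < a"
    by linarith
  then show False
    using no_three_concurrent_tangents[of _ _ _ q] assms by cases auto
qed

end

text \<open>One-sidedness keeps \<open>C\<close> off the diagonal and excludes the symmetry
  \<open>\<Psi> (r, s) = \<Psi> (s, r)\<close>, which would destroy injectivity.\<close>

locale tangent_chart = convex_arc +
  fixes C :: "(real \<times> real) set"
  assumes open_C: "open C" and C_subset: "C \<subseteq> J \<times> J"
    and one_sided: "(\<forall>(r, s)\<in>C. r < s) \<or> (\<forall>(r, s)\<in>C. s < r)"
begin

lemma C_memD:
  assumes "(r, s) \<in> C"
  shows "r \<in> J" "s \<in> J" "r \<noteq> s"
  using assms C_subset one_sided by auto

text \<open>A common image point lies on the tangents at \<open>r\<close>, \<open>s\<close>,
  \<open>r'\<close> and \<open>s'\<close>. Since at most two tangents pass through a point, the two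
  pairs agree up to order, and the order is fixed by \<open>one_sided\<close>.\<close>

lemma inj_tangent_intersection: "inj_on \<Psi> C"
proof (rule inj_onI, clarify)
  fix r s r' s' assume C: "(r, s) \<in> C" "(r', s') \<in> C" and eq: "\<Psi> (r, s) = \<Psi> (r', s')"
  define q where "q = \<Psi> (r, s)"
  have "q \<in> tangent_line \<gamma> r" "q \<in> tangent_line \<gamma> s"
    using tangent_intersection_eq[OF C_memD[OF C(1)]] tangent_line_inter[OF C_memD[OF C(1)]]
    by (auto simp: q_def)
  moreover have "q \<in> tangent_line \<gamma> r'" "q \<in> tangent_line \<gamma> s'"
    using tangent_intersection_eq[OF C_memD[OF C(2)]] tangent_line_inter[OF C_memD[OF C(2)]]
    by (auto simp: q_def eq)
  moreover have "r < s \<and> r' < s' \<or> s < r \<and> s' < r'"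
    using one_sided C by auto
  ultimately have "r' = r \<or> r' = s" "s' = r \<or> s' = s" "r < s \<and> r' < s' \<or> s < r \<and> s' < r'"
    using at_most_two_tangents[of r s r' q] at_most_two_tangents[of r s s' q] C[THEN C_memD(1)]
      C[THEN C_memD(2)] C[THEN C_memD(3)] by auto
  then show "r = r' \<and> s = s'"
    by auto
qed

lemma smooth_on_fst_snd:
  assumes "smooth_on J f"
  shows "smooth_on C (\<lambda>x. f (fst x))" "smooth_on C (\<lambda>x. f (snd x))"
  using C_subset by (auto intro!: smooth_on_compose[OF assms] smooth_on_fst smooth_on_snd open_C)

lemma smooth_on_offset:
  "smooth_on C (\<lambda>x. offset \<gamma> (fst x) (snd x))" "smooth_on C (\<lambda>x. offset \<gamma> (snd x) (fst x))"
  unfolding offset_def gap_def turn_def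
  using C_memD turn_nonzero[unfolded turn_def]
  by (intro smooth_on_divide smooth_on_minus smooth_on_bilinear[OF bounded_bilinear_omega] smooth_on_diff
      smooth_on_fst_snd smooth_\<gamma> smooth_velocity; fastforce)+

lemma smooth_on_tangent_intersection: "smooth_on C \<Psi>"
proof (rule smooth_on_cong)
  show "smooth_on C (\<lambda>x. \<gamma> (fst x) + offset \<gamma> (fst x) (snd x) *\<^sub>R velocity \<gamma> (fst x))"
    by (intro smooth_on_add smooth_on_scaleR smooth_on_offset smooth_on_fst_snd smooth_\<gamma> smooth_velocity)
  show "\<Psi> x = \<gamma> (fst x) + offset \<gamma> (fst x) (snd x) *\<^sub>R velocity \<gamma> (fst x)" if "x \<in> C" for x
    using tangent_intersection_eq(1) C_memD that by (cases x) auto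
qed

definition d\<Psi> :: "real \<times> real \<Rightarrow> real \<times> real \<Rightarrow> plane" where
  "d\<Psi> x = frechet_derivative \<Psi> (at x)"

lemma \<Psi>_has_derivative: "x \<in> C \<Longrightarrow> (\<Psi> has_derivative d\<Psi> x) (at x)"
  using smooth_onD(4)[OF smooth_on_tangent_intersection] by (simp add: d\<Psi>_def)

text \<open>Obtained by differentiating the condition that \<open>\<Psi> (r, s)\<close> lies on \<open>T\<^sub>r\<close> and \<open>T\<^sub>s\<close>.\<close>

lemma omega_d\<Psi>:
  assumes "(r, s) \<in> C"
  shows "omega (d\<Psi> (r, s) (h, k)) (velocity \<gamma> r) = - h * (offset \<gamma> r s * bend \<gamma> r r)"
    and "omega (d\<Psi> (r, s) (h, k)) (velocity \<gamma> s) = - k * (offset \<gamma> s r * bend \<gamma> s s)"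
proof -
  note rs = C_memD[OF assms]
  \<comment> \<open>Both tangents are treated at once, with \<open>\<pi>\<close> the projection to
    the parameter of the tangent. As \<open>\<Psi> (r, s) - \<gamma> p\<close> is \<open>t\<close>
    times the velocity, its pairing with the acceleration gives the term
    \<open>t * bend \<gamma> p p\<close>.\<close>
  have gen: "omega (d\<Psi> (r, s) v) (velocity \<gamma> p) = - \<pi> v * (t * bend \<gamma> p p)"
    if \<pi>: "bounded_linear \<pi>" "\<pi> (r, s) = p" "p \<in> J"
      and on: "\<And>x. x \<in> C \<Longrightarrow> omega (\<Psi> x - \<gamma> (\<pi> x)) (velocity \<gamma> (\<pi> x)) = 0"
      and t: "\<Psi> (r, s) = \<gamma> p + t *\<^sub>R velocity \<gamma> p" for \<pi> p t v
  proof -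
    have "(\<pi> has_derivative \<pi>) (at (r, s))"
      using \<pi>(1) by (rule bounded_linear_imp_has_derivative)
    then have g: "((\<lambda>x. f (\<pi> x)) has_derivative (\<lambda>v. \<pi> v *\<^sub>R f')) (at (r, s))"
      if "(f has_vector_derivative f') (at p)" for f and f' :: plane
      using has_derivative_compose[of \<pi> \<pi> "(r, s)" UNIV f] that \<pi>(2) by (simp add: has_vector_derivative_def)
    have "((\<lambda>x. omega (\<Psi> x - \<gamma> (\<pi> x)) (velocity \<gamma> (\<pi> x))) has_derivative
        (\<lambda>v. omega (\<Psi> (r, s) - \<gamma> (\<pi> (r, s))) (\<pi> v *\<^sub>R accel \<gamma> p) +
           omega (d\<Psi> (r, s) v - \<pi> v *\<^sub>R velocity \<gamma> p) (velocity \<gamma> (\<pi> (r, s))))) (at (r, s))"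
      by (intro omega.FDERIV has_derivative_diff g \<Psi>_has_derivative assms \<gamma>_deriv velocity_deriv \<pi>)
    moreover have "((\<lambda>x. omega (\<Psi> x - \<gamma> (\<pi> x)) (velocity \<gamma> (\<pi> x))) has_derivative (\<lambda>v. 0)) (at (r, s))"
      by (rule has_derivative_transform_within_open[OF has_derivative_const open_C assms]) (use on in simp)
    ultimately have "omega (\<Psi> (r, s) - \<gamma> p) (\<pi> v *\<^sub>R accel \<gamma> p) +
           omega (d\<Psi> (r, s) v - \<pi> v *\<^sub>R velocity \<gamma> p) (velocity \<gamma> p) = 0"
      unfolding \<pi>(2) by (metis (no_types, lifting) has_derivative_unique)
    then show ?thesis
      by (simp add: t bend_def omega.diff_left omega.scaleR_left omega.scaleR_right)
  qed
  have on: "omega (\<Psi> x - \<gamma> (fst x)) (velocity \<gamma> (fst x)) = 0"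
    "omega (\<Psi> x - \<gamma> (snd x)) (velocity \<gamma> (snd x)) = 0" if "x \<in> C" for x
    using tangent_intersection_eq[of "fst x" "snd x"] C_memD[of "fst x" "snd x"] that
    by (metis add_diff_cancel_left' omega.scaleR_left omega_self prod.collapse scaleR_zero_right)+
  show "omega (d\<Psi> (r, s) (h, k)) (velocity \<gamma> r) = - h * (offset \<gamma> r s * bend \<gamma> r r)"
    using gen[OF bounded_linear_fst _ rs(1) on(1) tangent_intersection_eq(1)[OF rs]] by simp
  show "omega (d\<Psi> (r, s) (h, k)) (velocity \<gamma> s) = - k * (offset \<gamma> s r * bend \<gamma> s s)"
    using gen[OF bounded_linear_snd _ rs(2) on(2) tangent_intersection_eq(2)[OF rs]] by simp
qed

text \<open>With \<open>s\<close> fixed the meeting point slides along the tangent at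
  \<open>s\<close>, so the derivative in \<open>r\<close> is a multiple of the velocity at
  \<open>s\<close>, and vice versa. The coefficients are read off from
  \<open>omega_d\<Psi>\<close>.\<close>

lemma d\<Psi>_eq:
  assumes "(r, s) \<in> C"
  shows "d\<Psi> (r, s) (h, k) = (h * (offset \<gamma> r s * bend \<gamma> r r) / turn \<gamma> r s) *\<^sub>R velocity \<gamma> s -
    (k * (offset \<gamma> s r * bend \<gamma> s s) / turn \<gamma> r s) *\<^sub>R velocity \<gamma> r"
proof (rule omega_eqI[of "velocity \<gamma> r" "velocity \<gamma> s"])
  have w: "omega (velocity \<gamma> r) (velocity \<gamma> s) \<noteq> 0" "omega (velocity \<gamma> s) (velocity \<gamma> r) \<noteq> 0"
    using turn_nonzero[OF C_memD[OF assms]] turn_commute[of \<gamma> r s] by (auto simp: turn_def)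
  show "omega (velocity \<gamma> r) (velocity \<gamma> s) \<noteq> 0"
    by (rule w)
qed (use turn_nonzero[OF C_memD[OF assms]] turn_commute[of \<gamma> s r] in
    \<open>auto simp: omega_d\<Psi>[OF assms] omega.diff_left omega.scaleR_left turn_def\<close>)

text \<open>The Jacobian splits into a function of \<open>r\<close>, a function of \<open>s\<close>,
  and a coupling factor. Only the latter survives in cross ratios; by \<open>gap_eq\<close> and
  \<open>turn_eq\<close> it has the order of \<open>s - r\<close>.\<close>

lemma omega_d\<Psi>_d\<Psi>:
  assumes "(r, s) \<in> C"
  shows "omega (d\<Psi> (r, s) (1, 0)) (d\<Psi> (r, s) (0, 1)) =
    bend \<gamma> r r * bend \<gamma> s s * (gap \<gamma> r s * gap \<gamma> s r / turn \<gamma> s r ^ 3)"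
proof -
  have "omega (d\<Psi> (r, s) (1, 0)) (d\<Psi> (r, s) (0, 1)) =
    (offset \<gamma> r s * bend \<gamma> r r / turn \<gamma> r s) * (offset \<gamma> s r * bend \<gamma> s s / turn \<gamma> r s) * turn \<gamma> r s"
    unfolding d\<Psi>_eq[OF assms] omega.scaleR_left omega.scaleR_right omega.minus_right
    by (simp add: omega.scaleR_left omega.scaleR_right omega.minus_right turn_def omega_commute[of "velocity \<gamma> s"])
  then show ?thesis
    using turn_nonzero[OF C_memD[OF assms]] turn_commute[of \<gamma> s r]
    by (simp add: offset_def field_simps power3_eq_cube)
qed

end

section \<open>The tangent web\<close>

lemma level_curvesD:
  assumes "L \<in> level_curves M u"
  shows "L \<noteq> {}" "connected L" "L \<subseteq> M" "\<exists>c. \<forall>q\<in>L. u q = c"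
proof -
  obtain c where "L \<in> components {q \<in> M. u q = c}"
    using assms by (auto simp: level_curves_def)
  from in_components_nonempty[OF this] in_components_connected[OF this] in_components_subset[OF this]
  show "L \<noteq> {}" "connected L" "L \<subseteq> M" "\<exists>c. \<forall>q\<in>L. u q = c"
    by auto
qed

lemma partition_on_level_curves: "partition_on M (level_curves M u)"
proof (rule partition_onI)
  have "\<Union>(level_curves M u) = (\<Union>c. \<Union>(components {q \<in> M. u q = c}))"
    unfolding level_curves_def by blast
  also have "\<dots> = (\<Union>c. {q \<in> M. u q = c})"
    by (simp only: Union_components)
  finally have "\<Union>(level_curves M u) = (\<Union>c. {q \<in> M. u q = c})" .
  then show "\<Union>(level_curves M u) = M"
    by auto
  show "{} \<notin> level_curves M u"
    using level_curvesD(1) by blast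
  fix L L' assume L: "L \<in> level_curves M u" "L' \<in> level_curves M u" "L \<noteq> L'"
  obtain c c' where c: "L \<in> components {q \<in> M. u q = c}" "L' \<in> components {q \<in> M. u q = c'}"
    using L by (auto simp: level_curves_def)
  show "disjnt L L'"
  proof (cases "c = c'")
    case True
    then show ?thesis
      using components_eq[of L _ L'] c L(3) by (auto simp: disjnt_def)
  next
    case False
    then show ?thesis
      using c[THEN in_components_subset] by (auto simp: disjnt_def)
  qed
qed

lemma components_level_curves: "(\<Union>L\<in>level_curves M u. components (L \<inter> M)) = level_curves M u"
proof -
  have "components (L \<inter> M) = {L}" if "L \<in> level_curves M u" for L
    using level_curvesD[OF that] by (metis Int_absorb2 connected_eq_connected_components_eq components_eq_sing_iff)
  then show ?thesis by auto
qed

text \<open>The globally defined \<open>u\<close> serves as local first integral at every point,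
  with \<open>V = M\<close>.\<close>

lemma foliation_level_curves:
  assumes "smooth_on M u" "\<And>q. q \<in> M \<Longrightarrow> frechet_derivative u (at q) \<noteq> (\<lambda>_. 0)"
    and "\<And>L. L \<in> level_curves M u \<Longrightarrow> path_connected L"
  shows "first_integral (level_curves M u) M u" "foliation M (level_curves M u)"
proof -
  show "first_integral (level_curves M u) M u"
    using assms(1,2) components_level_curves by (auto simp: first_integral_def)
  then show "foliation M (level_curves M u)"
    using smooth_onD(1)[OF assms(1)] partition_on_level_curves assms(3)
    unfolding foliation_def by blast
qed

section \<open>The inverse chart and the web of its coordinates\<close>

context tangent_chart
begin

abbreviation "M \<equiv> \<Psi> ` C"
abbreviation "\<Phi> \<equiv> the_inv_into C \<Psi>"

lemma \<Phi>_\<Psi> [simp]: "x \<in> C \<Longrightarrow> \<Phi> (\<Psi> x) = x"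
  by (rule the_inv_into_f_f[OF inj_tangent_intersection])

lemma \<Phi>_mem [simp]: "q \<in> M \<Longrightarrow> \<Phi> q \<in> C"
  and \<Psi>_\<Phi> [simp]: "q \<in> M \<Longrightarrow> \<Psi> (\<Phi> q) = q"
  by auto

text \<open>Invariance of domain gives openness before anything is known about derivatives of the
  inverse.\<close>

lemma open_M: "open M"
  by (rule invariance_of_domain[OF smooth_onD(3)[OF smooth_on_tangent_intersection] open_C inj_tangent_intersection])

lemma continuous_on_\<Phi>: "continuous_on M \<Phi>"
  by (rule continuous_on_inverse_open[OF open_C smooth_onD(3)[OF smooth_on_tangent_intersection]]) auto

text \<open>The inverse of \<open>d\<Psi> (r, s)\<close>, obtained by solving the two equations of
  \<open>omega_d\<Psi>\<close> for \<open>h\<close> and \<open>k\<close>. The direction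
  \<open>z\<close> comes first, so that \<open>d\<Phi> z\<close> is a function on \<open>C\<close>
  as required by \<open>smooth_on_autonomous\<close>.\<close>

definition d\<Phi> :: "plane \<Rightarrow> real \<times> real \<Rightarrow> real \<times> real" where
  "d\<Phi> z x = (case x of (r, s) \<Rightarrow>
     (- omega z (velocity \<gamma> r) / (offset \<gamma> r s * bend \<gamma> r r),
      - omega z (velocity \<gamma> s) / (offset \<gamma> s r * bend \<gamma> s s)))"

lemma denominators_nonzero:
  assumes "(r, s) \<in> C"
  shows "offset \<gamma> r s * bend \<gamma> r r \<noteq> 0" "offset \<gamma> s r * bend \<gamma> s s \<noteq> 0"
  using offset_nonzero[of r s] offset_nonzero[of s r] bend_bounds(4) C_memD[OF assms] by auto

lemma smooth_on_d\<Phi>: "smooth_on C (d\<Phi> z)"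
proof -
  have "smooth_on C (\<lambda>x. (- omega z (velocity \<gamma> (fst x)) / (offset \<gamma> (fst x) (snd x) * bend \<gamma> (fst x) (fst x)),
      - omega z (velocity \<gamma> (snd x)) / (offset \<gamma> (snd x) (fst x) * bend \<gamma> (snd x) (snd x))))"
    using denominators_nonzero[unfolded bend_def]
    unfolding bend_def
    by (intro smooth_on_Pair smooth_on_divide smooth_on_minus smooth_on_bilinear[OF bounded_bilinear_omega]
        smooth_on_const open_C smooth_on_mult smooth_on_offset smooth_on_fst_snd smooth_velocity smooth_accel; fastforce)
  then show ?thesis
    by (simp add: d\<Phi>_def[abs_def] case_prod_unfold)
qed

text \<open>Continuity of \<open>\<Phi>\<close> is already known, so it suffices that the candidate
  is a bounded linear left inverse of the derivative of \<open>\<Psi>\<close>; the latter is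
  immediate from \<open>omega_d\<Psi>\<close>.\<close>

lemma \<Phi>_has_derivative:
  assumes "q \<in> M"
  shows "(\<Phi> has_derivative (\<lambda>z. d\<Phi> z (\<Phi> q))) (at q)"
proof -
  obtain r s where rs: "(r, s) \<in> C" "\<Phi> q = (r, s)" "q = \<Psi> (r, s)"
    using assms by auto
  have lin: "bounded_linear (\<lambda>z. - omega z a / d)" for a d
    by (intro bounded_linear_compose[OF bounded_linear_divide] bounded_linear_minus omega.bounded_linear_left)
  have "(\<Phi> has_derivative (\<lambda>z. d\<Phi> z (r, s))) (at (\<Psi> (r, s)))"
  proof (rule has_derivative_inverse_dieudonne[OF open_C open_M _ continuous_on_\<Phi> \<Phi>_\<Psi> rs(1) \<Psi>_has_derivative[OF rs(1)]])
    show "continuous_on C \<Psi>"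
      by (rule smooth_onD(3)[OF smooth_on_tangent_intersection])
    show "bounded_linear (\<lambda>z. d\<Phi> z (r, s))"
      unfolding d\<Phi>_def case_prod_conv by (intro bounded_linear_Pair lin)
    show "(\<lambda>z. d\<Phi> z (r, s)) \<circ> d\<Psi> (r, s) = id"
      using denominators_nonzero[OF rs(1)] by (auto simp: fun_eq_iff d\<Phi>_def omega_d\<Psi>[OF rs(1)])
  qed
  then show ?thesis
    using rs by simp
qed

text \<open>The derivative of \<open>\<Phi>\<close> at \<open>q\<close> is a smooth function of the
  value \<open>\<Phi> q\<close>, so each order of smoothness yields the next.\<close>

lemma smooth_on_\<Phi>: "smooth_on M \<Phi>"
  by (rule smooth_on_autonomous[OF open_M _ \<Phi>_has_derivative smooth_on_d\<Phi>]) auto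

lemma diffeomorphism_\<Psi>: "diffeomorphism_between C M \<Psi>"
  using smooth_on_\<Phi> smooth_on_tangent_intersection inj_tangent_intersection
  by (auto simp: diffeomorphism_between_def bij_betw_def)

lemma frechet_derivative_\<Phi>:
  assumes "q \<in> M"
  shows "frechet_derivative (\<lambda>q. fst (\<Phi> q)) (at q) = (\<lambda>z. fst (d\<Phi> z (\<Phi> q)))"
    and "frechet_derivative (\<lambda>q. snd (\<Phi> q)) (at q) = (\<lambda>z. snd (d\<Phi> z (\<Phi> q)))"
  using frechet_derivative_at[OF has_derivative_fst[OF \<Phi>_has_derivative[OF assms]]]
    frechet_derivative_at[OF has_derivative_snd[OF \<Phi>_has_derivative[OF assms]]] by simp_all

lemma wedge_d_\<Phi>:
  assumes "q \<in> M"
  shows "wedge_d (\<lambda>q. fst (\<Phi> q)) (\<lambda>q. snd (\<Phi> q)) q \<noteq> 0"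
proof -
  obtain r s where rs: "(r, s) \<in> C" "\<Phi> q = (r, s)"
    using assms by auto
  have "wedge_d (\<lambda>q. fst (\<Phi> q)) (\<lambda>q. snd (\<Phi> q)) q =
      turn \<gamma> r s / ((offset \<gamma> r s * bend \<gamma> r r) * (offset \<gamma> s r * bend \<gamma> s s))"
    unfolding wedge_d_def frechet_derivative_\<Phi>[OF assms] rs(2)
    by (simp add: d\<Phi>_def omega_def turn_def diff_divide_distrib mult_ac)
  then show ?thesis
    using turn_nonzero[OF C_memD[OF rs(1)]] denominators_nonzero[OF rs(1)] by simp
qed

text \<open>Connected subsets of the line are intervals, hence path-connected. On a leaf one
  coordinate of \<open>\<Phi>\<close> is constant: \<open>\<pi>\<close> extracts the other one, and
  \<open>\<iota>\<close> reinserts the constant.\<close>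

lemma path_connected_in_M:
  assumes "connected L" "L \<subseteq> M" "continuous_on UNIV \<pi>" "continuous_on UNIV \<iota>"
    and "\<And>q. q \<in> L \<Longrightarrow> \<iota> (\<pi> (\<Phi> q) :: real) = \<Phi> q"
  shows "path_connected L"
proof -
  let ?A = "(\<lambda>q. \<pi> (\<Phi> q)) ` L"
  have "connected ?A"
    by (intro connected_continuous_image continuous_on_compose2[OF assms(3)]
        continuous_on_subset[OF continuous_on_\<Phi>] assms) auto
  then have "path_connected ?A"
    using is_interval_connected_1 is_interval_path_connected by blast
  moreover have "continuous_on ?A (\<lambda>a. \<Psi> (\<iota> a))"
  proof (rule continuous_on_compose2[OF smooth_onD(3)[OF smooth_on_tangent_intersection]])
    show "\<iota> ` ?A \<subseteq> C"
      unfolding image_image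
    proof (rule image_subsetI)
      fix q assume "q \<in> L"
      then show "\<iota> (\<pi> (\<Phi> q)) \<in> C"
        unfolding assms(5)[OF \<open>q \<in> L\<close>] by (intro \<Phi>_mem subsetD[OF assms(2)])
    qed
  qed (rule continuous_on_subset[OF assms(4)], simp)
  ultimately have "path_connected ((\<lambda>a. \<Psi> (\<iota> a)) ` ?A)"
    by (rule path_connected_continuous_image[rotated])
  moreover have "(\<lambda>a. \<Psi> (\<iota> a)) ` ?A = L"
  proof -
    have "(\<lambda>a. \<Psi> (\<iota> a)) ` ?A = (\<lambda>q. q) ` L"
      unfolding image_image using assms(2,5) by (intro image_cong) auto
    then show ?thesis by simp
  qed
  ultimately show ?thesis by simp
qed

lemma lagrangian_2_web_tangent_web: "lagrangian_2_web M (tangent_web \<gamma> C)"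
proof -
  let ?u = "\<lambda>q. fst (\<Phi> q)" and ?v = "\<lambda>q. snd (\<Phi> q)"
  have smooth: "smooth_on M ?u" "smooth_on M ?v"
    by (intro smooth_on_linear[OF bounded_linear_fst] smooth_on_linear[OF bounded_linear_snd] smooth_on_\<Phi>)+
  have nz: "frechet_derivative ?u (at q) \<noteq> (\<lambda>_. 0)" "frechet_derivative ?v (at q) \<noteq> (\<lambda>_. 0)" if "q \<in> M" for q
    using wedge_d_\<Phi>[OF that] by (auto simp: wedge_d_def)
  have "path_connected L" if "L \<in> level_curves M ?u" for L
  proof -
    obtain c where "\<forall>q\<in>L. ?u q = c"
      using level_curvesD(4)[OF \<open>L \<in> level_curves M ?u\<close>] by blast
    then show ?thesis
      by (intro path_connected_in_M[OF level_curvesD(2,3)[OF that], where \<pi>=snd and \<iota>="Pair c"]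
        continuous_intros) auto
  qed
  moreover have "path_connected L" if "L \<in> level_curves M ?v" for L
  proof -
    obtain c where "\<forall>q\<in>L. ?v q = c"
      using level_curvesD(4)[OF \<open>L \<in> level_curves M ?v\<close>] by blast
    then show ?thesis
      by (intro path_connected_in_M[OF level_curvesD(2,3)[OF that], where \<pi>=fst and \<iota>="\<lambda>x. (x, c)"]
        continuous_intros) auto
  qed
  ultimately show ?thesis
    using foliation_level_curves[OF smooth(1) nz(1)] foliation_level_curves[OF smooth(2) nz(2)]
      wedge_d_\<Phi> open_M
    unfolding lagrangian_2_web_def tangent_web_def Let_def fst_conv snd_conv by blast
qed

end

section \<open>Areas of images in the plane\<close>

text \<open>The change of variables theorem \<open>has_measure_differentiable_image\<close> is
  formulated with determinants of matrices, hence for \<open>real^2\<close>; this map and its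
  inverse transport it to pairs.\<close>

definition plane_of_vec :: "real^2 \<Rightarrow> plane" where
  "plane_of_vec x = (x $ 1, x $ 2)"

definition vec_of_plane :: "plane \<Rightarrow> real^2" where
  "vec_of_plane p = vector [fst p, snd p]"

lemma plane_of_vec_of_plane [simp]: "plane_of_vec (vec_of_plane p) = p"
  by (simp add: plane_of_vec_def vec_of_plane_def)

lemma vec_of_plane_of_vec [simp]: "vec_of_plane (plane_of_vec x) = x"
  by (simp add: plane_of_vec_def vec_of_plane_def vec_eq_iff forall_2)

lemma vec_of_plane_image: "vec_of_plane ` A = plane_of_vec -` A"
proof
  show "plane_of_vec -` A \<subseteq> vec_of_plane ` A"
  proof
    fix x assume "x \<in> plane_of_vec -` A"
    then show "x \<in> vec_of_plane ` A"
      by (intro image_eqI[of _ _ "plane_of_vec x"]) auto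
  qed
qed auto

lemma bounded_linear_plane_of_vec: "bounded_linear plane_of_vec"
  unfolding plane_of_vec_def[abs_def] by (intro bounded_linear_Pair bounded_linear_vec_nth)

lemma bounded_linear_vec_of_plane: "bounded_linear vec_of_plane"
  by (rule linear_conv_bounded_linear[THEN iffD1]) (auto intro!: linearI simp: vec_of_plane_def vec_eq_iff forall_2)

text \<open>Lebesgue measure is characterised by its values on boxes, and boxes correspond to boxes
  with the same side lengths.\<close>

lemma lborel_plane: "(lborel :: plane measure) = distr lborel borel plane_of_vec"
proof (rule lborel_eqI)
  have [measurable]: "plane_of_vec \<in> borel_measurable borel"
    using bounded_linear_plane_of_vec
    by (intro borel_measurable_continuous_onI linear_continuous_on)
  fix l u :: plane assume le: "\<And>b. b \<in> Basis \<Longrightarrow> l \<bullet> b \<le> u \<bullet> b"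
  have B: "Basis = {(1, 0), (0, 1 :: real) :: plane}"
    by (auto simp: Basis_prod_def)
  have B2: "Basis = {axis 1 1, axis 2 1 :: real^2}"
    by (auto simp: Basis_vec_def UNIV_2)
  have "plane_of_vec -` box l u = box (vec_of_plane l) (vec_of_plane u)"
    by (auto simp: plane_of_vec_def vec_of_plane_def box_def B B2 inner_axis inner_prod_def)
  then have "emeasure (distr lborel borel plane_of_vec) (box l u) = emeasure lborel (box (vec_of_plane l) (vec_of_plane u))"
    by (simp add: emeasure_distr)
  also have "\<dots> = (\<Prod>b\<in>Basis. (vec_of_plane u - vec_of_plane l) \<bullet> b)"
    using le[of "(1, 0)"] le[of "(0, 1)"]
    by (intro emeasure_lborel_box) (auto simp: B B2 inner_axis vec_of_plane_def inner_prod_def)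
  also have "(\<Prod>b\<in>Basis. (vec_of_plane u - vec_of_plane l) \<bullet> b) = (\<Prod>b\<in>Basis. (u - l) \<bullet> b)"
    by (simp add: B B2 axis_eq_axis inner_axis vec_of_plane_def inner_prod_def)
  finally show "emeasure (distr lborel borel plane_of_vec) (box l u) = (\<Prod>b\<in>Basis. (u - l) \<bullet> b)" .
qed simp

lemma measure_vec_of_plane:
  assumes "open A"
  shows "measure lebesgue (vec_of_plane ` A) = measure lborel A"
proof -
  have meas: "plane_of_vec \<in> borel_measurable borel"
    using bounded_linear_plane_of_vec
    by (intro borel_measurable_continuous_onI linear_continuous_on)
  have "open (plane_of_vec -` A)"
    using bounded_linear_plane_of_vec by (intro open_vimage assms linear_continuous_on)
  then have "measure lebesgue (vec_of_plane ` A) = measure lborel (plane_of_vec -` A)"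
    by (simp add: vec_of_plane_image)
  also have "\<dots> = measure (distr lborel borel plane_of_vec) A"
    using assms meas by (subst measure_distr) auto
  also have "\<dots> = measure lborel A"
    by (simp only: lborel_plane)
  finally show ?thesis .
qed

text \<open>The area of the image is the integral of the absolute Jacobian, which is compared with
  constants. Two-sided bounds suffice, since they serve only for a limit over shrinking
  squares.\<close>

lemma measure_image_plane_bounds:
  fixes f :: "plane \<Rightarrow> plane"
  assumes "open S" "bounded S" "bounded (f ` S)" "inj_on f S"
    and der: "\<And>x. x \<in> S \<Longrightarrow> (f has_derivative f' x) (at x)"
    and jac: "\<And>x. x \<in> S \<Longrightarrow> \<bar>omega (f' x (1, 0)) (f' x (0, 1))\<bar> \<in> {d..e}"
  shows "d * measure lborel S \<le> measure lborel (f ` S)" "measure lborel (f ` S) \<le> e * measure lborel S"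
proof -
  let ?p = plane_of_vec and ?v = vec_of_plane
  let ?g = "\<lambda>y. ?v (f (?p y))" and ?g' = "\<lambda>y z. ?v (f' (?p y) (?p z))" and ?T = "?v ` S"
  note lin = bounded_linear_plane_of_vec bounded_linear_vec_of_plane
  have opn: "open (?v ` A)" if "open A" for A
    unfolding vec_of_plane_image using lin by (intro open_vimage that linear_continuous_on)
  have bnd: "bounded (?v ` A)" if "bounded A" for A
    using bounded_linear_image[OF that lin(2)] .
  have gT: "?g ` ?T = ?v ` (f ` S)"
    by (simp add: image_image)
  have "open (f ` S)"
    using assms(1,4) der
    by (intro invariance_of_domain continuous_at_imp_continuous_on) (auto intro: has_derivative_continuous)
  then have "open (?g ` ?T)" "bounded (?g ` ?T)"
    unfolding gT using assms(3) by (auto intro: opn bnd)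
  then have "?g ` ?T \<in> lmeasurable"
    by (auto intro: lmeasurable_open)
  have T: "?T \<in> lmeasurable" "?T \<in> sets lebesgue"
    using opn[OF assms(1)] bnd[OF assms(2)] by (auto intro: lmeasurable_open)
  have det: "det (matrix (?g' y)) = omega (f' (?p y) (1, 0)) (f' (?p y) (0, 1))" for y
    by (simp add: det_2 matrix_def omega_def vec_of_plane_def plane_of_vec_def axis_def)
  have "((\<lambda>y. \<bar>det (matrix (?g' y))\<bar>) has_integral measure lebesgue (?g ` ?T)) ?T"
  proof (rule has_measure_differentiable_image[THEN iffD1])
    show "(?g has_derivative ?g' y) (at y within ?T)" if "y \<in> ?T" for y
    proof -
      have "?p y \<in> S" using that by auto
      have "((\<lambda>y. f (?p y)) has_derivative (\<lambda>z. f' (?p y) (?p z))) (at y)"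
        by (rule has_derivative_compose[OF bounded_linear_imp_has_derivative[OF lin(1)] der[OF \<open>?p y \<in> S\<close>]])
      from bounded_linear.has_derivative[OF lin(2) this] show ?thesis
        by (rule has_derivative_at_withinI)
    qed
    show "inj_on ?g ?T"
    proof (rule inj_onI)
      fix y z assume yz: "y \<in> ?T" "z \<in> ?T" "?g y = ?g z"
      from arg_cong[OF yz(3), of ?p] have "f (?p y) = f (?p z)"
        by (simp only: plane_of_vec_of_plane)
      then have "?p y = ?p z"
        using inj_onD[OF assms(4)] yz(1,2) unfolding vec_of_plane_image by blast
      from arg_cong[OF this, of ?v] show "y = z"
        by (simp only: vec_of_plane_of_vec)
    qed
  qed (use T \<open>?g ` ?T \<in> lmeasurable\<close> in auto)
  note I = this[unfolded gT measure_vec_of_plane[OF \<open>open (f ` S)\<close>]]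
  have c: "((\<lambda>y. c) has_integral c * measure lborel S) ?T" for c :: real
  proof -
    have "((\<lambda>y. 1 :: real) has_integral measure lborel S) ?T"
      using T(1) measure_vec_of_plane[OF assms(1)]
      by (metis integrable_integral lmeasurable_iff_integrable_on lmeasure_integral)
    from has_integral_mult_right[OF this, of c] show ?thesis by simp
  qed
  show "d * measure lborel S \<le> measure lborel (f ` S)"
    by (rule has_integral_le[OF c I]) (use jac in \<open>auto simp: det\<close>)
  show "measure lborel (f ` S) \<le> e * measure lborel S"
    by (rule has_integral_le[OF I c]) (use jac in \<open>auto simp: det\<close>)
qed

section \<open>Densities and the Samuelson condition\<close>

lemma measure_lborel_open_rectangle:
  fixes a b c d :: real
  assumes "a \<le> b" "c \<le> d"
  shows "measure lborel ({a<..<b} \<times> {c<..<d}) = (b - a) * (d - c)"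
proof -
  have B: "Basis = {(1, 0), (0, 1 :: real) :: plane}"
    by (auto simp: Basis_prod_def)
  have "{a<..<b} \<times> {c<..<d} = box (a, c) (b, d)"
    by (auto simp: box_def B)
  then show ?thesis
    using assms by (simp add: measure_lborel_box_eq B)
qed

lemma measure_lborel_open_pos:
  fixes U :: "'a::euclidean_space set"
  assumes "open U" "bounded U" "U \<noteq> {}"
  shows "0 < measure lborel U"
proof -
  have "measure lebesgue U \<noteq> 0"
    using open_not_negligible[OF assms(1,3)] lmeasurable_open[OF assms(2,1)]
    by (simp add: negligible_iff_measure0)
  then show ?thesis
    using assms(1) by (simp add: less_le)
qed

text \<open>A continuous injective map on an interval is monotone; \<open>min\<close> and
  \<open>max\<close> allow for a decreasing one.\<close>

lemma inj_image_open_interval: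
  fixes f :: "real \<Rightarrow> real"
  assumes "continuous_on K f" "inj_on f K" "is_interval K" "x \<in> K" "y \<in> K" "x < y"
  shows "f ` {x<..<y} = {min (f x) (f y)<..<max (f x) (f y)}"
proof
  have K: "{x..y} \<subseteq> K"
    using mem_is_interval_1_I[OF assms(3,4,5)] by auto
  then have cont: "continuous_on {x..y} f" and inj: "inj_on f {x..y}"
    using assms continuous_on_subset inj_on_subset by blast+
  show "f ` {x<..<y} \<subseteq> {min (f x) (f y)<..<max (f x) (f y)}"
    using continuous_inj_imp_mono[OF _ _ cont inj] by fastforce
  show "{min (f x) (f y)<..<max (f x) (f y)} \<subseteq> f ` {x<..<y}"
  proof
    fix z assume z: "z \<in> {min (f x) (f y)<..<max (f x) (f y)}"
    have "is_interval (f ` {x..y})"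
      using cont by (simp add: is_interval_connected_1 connected_continuous_image)
    moreover have "f x \<in> f ` {x..y}" "f y \<in> f ` {x..y}"
      using assms(6) by auto
    ultimately have "z \<in> f ` {x..y}"
      using z mem_is_interval_1_I[of "f ` {x..y}"]
      by (metis greaterThanLessThan_iff less_imp_le max_def min_def)
    then obtain c where c: "c \<in> {x..y}" "z = f c"
      by auto
    moreover have "c \<noteq> x" "c \<noteq> y"
      using z c by auto
    ultimately show "z \<in> f ` {x<..<y}"
      by auto
  qed
qed

text \<open>A change of parameter \<open>f\<close> may reverse the order of two adjacent intervals.\<close>

lemma adjacent_interval_preimages:
  fixes f :: "real \<Rightarrow> real"
  assumes "continuous_on K f" "inj_on f K" "is_interval K"
    and "{a0, a1, a2} \<subseteq> f ` K" "a0 < a1" "a1 < a2"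
  obtains x0 x1 x2 where "{x0, x1, x2} \<subseteq> K" "x0 < x1" "x1 < x2"
    "f ` {x0<..<x1} = {a0<..<a1} \<and> f ` {x1<..<x2} = {a1<..<a2} \<or>
     f ` {x0<..<x1} = {a1<..<a2} \<and> f ` {x1<..<x2} = {a0<..<a1}"
proof -
  obtain y0 y1 y2 where y: "y0 \<in> K" "y1 \<in> K" "y2 \<in> K" "f y0 = a0" "f y1 = a1" "f y2 = a2"
    using assms(4) by auto
  note im = inj_image_open_interval[OF assms(1,2,3)]
  consider "strict_mono_on K f" | "strict_antimono_on K f"
    using injective_eq_monotone_map[OF assms(3,1)] assms(2) by blast
  then show ?thesis
  proof cases
    case 1
    then have "y0 < y1" "y1 < y2"
      using strict_mono_on_less[OF 1] y assms(5,6) by auto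
    then show ?thesis
      using that[of y0 y1 y2] im y assms(5,6) by auto
  next
    case 2
    have anti: "x < x'" if "x \<in> K" "x' \<in> K" "f x' < f x" for x x'
      using monotone_onD[OF 2 that(2,1)] that(3) by (metis less_asym linorder_neqE)
    then have "y1 < y0" "y2 < y1"
      using y assms(5,6) by auto
    then show ?thesis
      using that[of y2 y1 y0] im y assms(5,6) by auto
  qed
qed

text \<open>A connected level set of \<open>u\<close> is its own only component, so it is a plaque
  of a single leaf, and \<open>\<rho>\<close> is constant on leaves. Thus \<open>\<rho>\<close> is a
  function of \<open>u\<close> on \<open>V\<close> when all level sets are connected.\<close>

lemma first_integral_level:
  assumes "first_integral (level_curves M \<rho>) V u" "connected {q \<in> V. u q = c}"
    and "q \<in> V" "u q = c" "q' \<in> V" "u q' = c"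
  shows "\<rho> q = \<rho> q'"
proof -
  let ?S = "{q \<in> V. u q = c}"
  have "?S \<noteq> {}"
    using assms(3,4) by blast
  then have "components ?S = {?S}"
    using assms(2) by (simp add: components_eq_sing_iff)
  then have "?S \<in> level_curves V u"
    unfolding level_curves_def by blast
  then obtain L where L: "L \<in> level_curves M \<rho>" "?S \<in> components (L \<inter> V)"
    using assms(1) unfolding first_integral_def by blast
  have "q \<in> L" "q' \<in> L"
    using in_components_subset[OF L(2)] assms(3-6) by blast+
  then show ?thesis
    using level_curvesD(4)[OF L(1)] by metis
qed

section \<open>From ratios of areas to an identity for the Jacobian\<close>

context tangent_chart
begin

definition patch_area :: "real \<Rightarrow> real \<Rightarrow> real \<Rightarrow> real \<Rightarrow> real" where
  "patch_area a b c d = measure lborel (\<Psi> ` ({a<..<b} \<times> {c<..<d}))"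

definition density :: "real \<times> real \<Rightarrow> real" where
  "density x = \<bar>omega (d\<Psi> x (1, 0)) (d\<Psi> x (0, 1))\<bar>"

lemma continuous_on_density: "continuous_on C density"
proof -
  have "continuous_on C (\<lambda>x. d\<Psi> x v)" for v
    using smooth_onD(3)[OF smooth_onD(5)[OF smooth_on_tangent_intersection]] by (simp add: d\<Psi>_def)
  then show ?thesis
    unfolding density_def by (intro continuous_intros omega.continuous_on)
qed

text \<open>The closed rectangle is assumed to lie in \<open>C\<close> because its compact image
  bounds that of the open one; the area is then finite, and \<open>measure\<close> does not fall
  back to 0.\<close>

lemma patch_properties:
  assumes "{a..b} \<times> {c..d} \<subseteq> C" "a < b" "c < d"
  shows "0 < patch_area a b c d"
    and "(\<And>x. x \<in> {a..b} \<times> {c..d} \<Longrightarrow> density x \<in> {m..n}) \<Longrightarrow>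
      m * ((b - a) * (d - c)) \<le> patch_area a b c d \<and> patch_area a b c d \<le> n * ((b - a) * (d - c))"
proof -
  let ?R = "{a<..<b} \<times> {c<..<d}"
  have R: "?R \<subseteq> {a..b} \<times> {c..d}" "open ?R" "bounded ?R"
    by (auto intro!: open_Times bounded_Times)
  then have RC: "?R \<subseteq> C"
    using assms(1) by blast
  note smooth = smooth_onD(3)[OF smooth_on_tangent_intersection]
  have "compact (\<Psi> ` ({a..b} \<times> {c..d}))"
    by (intro compact_continuous_image continuous_on_subset[OF smooth] assms(1) compact_Times compact_Icc)
  then have bnd: "bounded (\<Psi> ` ?R)"
    using R(1) by (meson bounded_subset compact_imp_bounded image_mono)
  have inj: "inj_on \<Psi> ?R"
    by (rule inj_on_subset[OF inj_tangent_intersection RC])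
  have "open (\<Psi> ` ?R)"
    by (intro invariance_of_domain continuous_on_subset[OF smooth RC] inj R)
  moreover have "((a + b) / 2, (c + d) / 2) \<in> ?R"
    using assms(2,3) by auto
  ultimately show "0 < patch_area a b c d"
    unfolding patch_area_def using bnd by (intro measure_lborel_open_pos) blast+
  assume dens: "\<And>x. x \<in> {a..b} \<times> {c..d} \<Longrightarrow> density x \<in> {m..n}"
  have "\<bar>omega (d\<Psi> x (1, 0)) (d\<Psi> x (0, 1))\<bar> \<in> {m..n}" if "x \<in> ?R" for x
    using dens[OF subsetD[OF R(1) that]] by (simp add: density_def)
  from measure_image_plane_bounds[OF R(2,3) bnd inj \<Psi>_has_derivative[OF subsetD[OF RC]] this]
  show "m * ((b - a) * (d - c)) \<le> patch_area a b c d \<and> patch_area a b c d \<le> n * ((b - a) * (d - c))"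
    unfolding patch_area_def using measure_lborel_open_rectangle[of a b c d] assms(2,3) by simp
qed

lemma patch_area_tendsto:
  assumes "(r, s) \<in> C"
  shows "((\<lambda>h. patch_area r (r + h) s (s + h) / (h * h)) \<longlongrightarrow> density (r, s)) (at_right 0)"
proof (rule tendstoI)
  fix e :: real assume "0 < e"
  have "\<forall>\<^sub>F x in nhds (r, s). x \<in> C"
    using open_C assms by (rule eventually_nhds_in_open)
  moreover have "\<forall>\<^sub>F x in nhds (r, s). dist (density x) (density (r, s)) < e / 2"
    using continuous_on_density open_C assms \<open>0 < e\<close>
    by (intro tendstoD) (auto simp: continuous_on_eq_continuous_at isCont_def tendsto_at_iff_tendsto_nhds)
  ultimately have "\<forall>\<^sub>F x in nhds (r, s). x \<in> C \<and> dist (density x) (density (r, s)) < e / 2"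
    by (rule eventually_conj)
  then obtain \<delta> where \<delta>: "0 < \<delta>" "\<And>x. dist x (r, s) < \<delta> \<Longrightarrow> x \<in> C \<and> dist (density x) (density (r, s)) < e / 2"
    by (auto simp: eventually_nhds_metric)
  have "dist (patch_area r (r + h) s (s + h) / (h * h)) (density (r, s)) < e" if "0 < h" "h < \<delta> / 2" for h
  proof -
    have near: "x \<in> C \<and> dist (density x) (density (r, s)) < e / 2" if x: "x \<in> {r..r + h} \<times> {s..s + h}" for x
    proof (rule \<delta>(2))
      have "dist x (r, s) \<le> \<bar>fst x - r\<bar> + \<bar>snd x - s\<bar>"
        by (cases x) (simp add: dist_Pair_Pair dist_real_def sqrt_sum_squares_le_sum_abs)
      also have "\<dots> < \<delta>"
        using x \<open>h < \<delta> / 2\<close> by (auto simp: abs_if)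
      finally show "dist x (r, s) < \<delta>" .
    qed
    have "(density (r, s) - e / 2) * ((r + h - r) * (s + h - s)) \<le> patch_area r (r + h) s (s + h) \<and>
        patch_area r (r + h) s (s + h) \<le> (density (r, s) + e / 2) * ((r + h - r) * (s + h - s))"
    proof (rule patch_properties(2))
      show "density x \<in> {density (r, s) - e / 2..density (r, s) + e / 2}" if "x \<in> {r..r + h} \<times> {s..s + h}" for x
        using near[OF that] unfolding dist_real_def abs_if atLeastAtMost_iff by (auto split: if_splits)
    qed (use near \<open>0 < h\<close> in auto)
    then have "density (r, s) - e / 2 \<le> patch_area r (r + h) s (s + h) / (h * h)"
      "patch_area r (r + h) s (s + h) / (h * h) \<le> density (r, s) + e / 2"
      using \<open>0 < h\<close> by (simp_all add: pos_le_divide_eq pos_divide_le_eq)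
    then show ?thesis
      using \<open>0 < e\<close> by (simp add: dist_real_def abs_if)
  qed
  then show "\<forall>\<^sub>F h in at_right 0. dist (patch_area r (r + h) s (s + h) / (h * h)) (density (r, s)) < e"
    using \<delta>(1) by (intro eventually_at_rightI[of 0 "\<delta> / 2"]) auto
qed

text \<open>The images of the squares of side \<open>h\<close> attached to the four corners satisfy
  the exchange identity for areas. Division by \<open>h * h\<close> and the limit turn areas into
  densities.\<close>

lemma density_exchange_strict:
  assumes AB: "is_interval A" "open A" "is_interval B" "open B" "A \<times> B \<subseteq> C"
    and ratio: "\<And>a0 a1 a2 b0 b1 b2. {a0, a1, a2} \<subseteq> A \<Longrightarrow> {b0, b1, b2} \<subseteq> B \<Longrightarrow>
      a0 < a1 \<Longrightarrow> a1 < a2 \<Longrightarrow> b0 < b1 \<Longrightarrow> b1 < b2 \<Longrightarrow>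
      patch_area a0 a1 b0 b1 / patch_area a0 a1 b1 b2 = patch_area a1 a2 b0 b1 / patch_area a1 a2 b1 b2"
    and ab: "a \<in> A" "a' \<in> A" "b \<in> B" "b' \<in> B" "a < a'" "b < b'"
  shows "density (a, b) * density (a', b') = density (a, b') * density (a', b)"
proof -
  define P where "P a b h = patch_area a (a + h) b (b + h)" for a b h
  have pos: "0 < patch_area a0 a1 b0 b1"
    if "a0 \<in> A" "a1 \<in> A" "b0 \<in> B" "b1 \<in> B" "a0 < a1" "b0 < b1" for a0 a1 b0 b1
  proof (rule patch_properties(1))
    show "{a0..a1} \<times> {b0..b1} \<subseteq> C"
      using mem_is_interval_1_I[OF AB(1) that(1,2)] mem_is_interval_1_I[OF AB(3) that(3,4)] AB(5) by auto
  qed (use that in auto)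
  have exch: "P a b h * P a' b' h = P a b' h * P a' b h"
    if h: "0 < h" "a + h < a'" "b + h < b'" "a' + h \<in> A" "b' + h \<in> B" for h
  proof -
    have A: "a + h \<in> A" and B: "b + h \<in> B"
      using mem_is_interval_1_I[OF AB(1) ab(1,2)] mem_is_interval_1_I[OF AB(3) ab(3,4)] h by auto
    \<comment> \<open>The ratio condition compares adjacent strips only; the strip between
      \<open>a + h\<close> and \<open>a'\<close> links the two narrow ones.\<close>
    have chain: "patch_area a (a + h) b0 b1 / patch_area a (a + h) b1 b2 =
      patch_area a' (a' + h) b0 b1 / patch_area a' (a' + h) b1 b2"
      if "{b0, b1, b2} \<subseteq> B" "b0 < b1" "b1 < b2" for b0 b1 b2
      using ratio[of a "a + h" a' b0 b1 b2] ratio[of "a + h" a' "a' + h" b0 b1 b2] that A h ab by simp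
    have c1: "P a b h / patch_area a (a + h) (b + h) b' = P a' b h / patch_area a' (a' + h) (b + h) b'"
      unfolding P_def using chain[of b "b + h" b'] B h ab by simp
    have c2: "patch_area a (a + h) (b + h) b' / P a b' h = patch_area a' (a' + h) (b + h) b' / P a' b' h"
      unfolding P_def using chain[of "b + h" b' "b' + h"] B h ab by simp
    have "0 < patch_area a (a + h) (b + h) b'" "0 < patch_area a' (a' + h) (b + h) b'"
      "0 < P a b' h" "0 < P a' b' h"
      unfolding P_def using pos A B h ab by simp_all
    \<comment> \<open>Multiplying \<open>c1\<close> and \<open>c2\<close> cancels the patches
      between \<open>b + h\<close> and \<open>b'\<close>, which play the same linking role in the
      second coordinate.\<close>
    then have "P a b h / P a b' h = P a' b h / P a' b' h"
      using arg_cong2[OF c1 c2, of "(*)"] by simp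
    then show ?thesis
      using \<open>0 < P a b' h\<close> \<open>0 < P a' b' h\<close> by (simp add: field_simps)
  qed
  have small: "\<forall>\<^sub>F h in at_right 0. x + h \<in> U" if "open U" "x \<in> U" for x :: real and U
  proof -
    have "((\<lambda>h. x + h) \<longlongrightarrow> x + 0) (at_right 0)"
      by (intro tendsto_intros)
    then show ?thesis
      using topological_tendstoD[of _ x] that by auto
  qed
  have ev: "\<forall>\<^sub>F h in at_right 0. P a b h / (h * h) * (P a' b' h / (h * h)) = P a b' h / (h * h) * (P a' b h / (h * h))"
  proof -
    have "a \<in> {..<a'}" "b \<in> {..<b'}"
      using ab by auto
    then have "\<forall>\<^sub>F h in at_right 0. a + h \<in> {..<a'}" "\<forall>\<^sub>F h in at_right 0. b + h \<in> {..<b'}"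
      by (auto intro: small simp del: lessThan_iff)
    with eventually_at_right_less[of "0 :: real"] small[OF AB(2) ab(2)] small[OF AB(4) ab(4)] show ?thesis
    proof eventually_elim
      case (elim h)
      then show ?case
        using exch[of h] by simp
    qed
  qed
  have lim: "((\<lambda>h. P x y h / (h * h)) \<longlongrightarrow> density (x, y)) (at_right 0)" if "x \<in> A" "y \<in> B" for x y
    unfolding P_def using that AB(5) by (intro patch_area_tendsto) auto
  have "((\<lambda>h. P a b h / (h * h) * (P a' b' h / (h * h))) \<longlongrightarrow> density (a, b') * density (a', b)) (at_right 0)"
    using tendsto_cong[OF ev] tendsto_mult[OF lim[OF ab(1,4)] lim[OF ab(2,3)]] by simp
  with tendsto_mult[OF lim[OF ab(1,3)] lim[OF ab(2,4)]] show ?thesis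
    by (intro tendsto_unique[of "at_right (0 :: real)"]) auto
qed

text \<open>On \<open>V\<close> the coordinates \<open>r\<close> and \<open>s\<close> are continuous
  injective functions of \<open>u\<close> and \<open>v\<close> separately, so the same
  quadrilaterals are cut out by both pairs of first integrals. The condition is thereby transferred
  from the unknown \<open>u\<close>, \<open>v\<close> to \<open>r\<close>, \<open>s\<close>.\<close>

lemma samuelson_rectangle:
  assumes "samuelson M (tangent_web \<gamma> C)" "(r, s) \<in> C"
  obtains A B where "is_interval A" "open A" "r \<in> A" "is_interval B" "open B" "s \<in> B" "A \<times> B \<subseteq> C"
    and "\<And>a0 a1 a2 b0 b1 b2. {a0, a1, a2} \<subseteq> A \<Longrightarrow> {b0, b1, b2} \<subseteq> B \<Longrightarrow>
      a0 < a1 \<Longrightarrow> a1 < a2 \<Longrightarrow> b0 < b1 \<Longrightarrow> b1 < b2 \<Longrightarrow>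
      patch_area a0 a1 b0 b1 / patch_area a0 a1 b1 b2 = patch_area a1 a2 b0 b1 / patch_area a1 a2 b1 b2"
proof -
  define p where "p = \<Psi> (r, s)"
  have "p \<in> M"
    using assms(2) by (auto simp: p_def)
  from bspec[OF assms(1)[unfolded samuelson_def tangent_web_def Let_def fst_conv snd_conv] this]
  obtain V u v K L where V: "open V" "p \<in> V" "V \<subseteq> M"
    and fi: "first_integral (level_curves M (\<lambda>q. fst (\<Phi> q))) V u" "first_integral (level_curves M (\<lambda>q. snd (\<Phi> q))) V v"
    and KL: "open K" "is_interval K" "open L" "is_interval L"
    and diffeo: "diffeomorphism_between V (K \<times> L) (\<lambda>q. (u q, v q))"
    and sam: "\<forall>u0\<in>K. \<forall>u1\<in>K. \<forall>u2\<in>K. \<forall>v0\<in>L. \<forall>v1\<in>L. \<forall>v2\<in>L.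
           u0 < u1 \<and> u1 < u2 \<and> v0 < v1 \<and> v1 < v2 \<longrightarrow>
           quad_area V u v u0 u1 v0 v1 / quad_area V u v u0 u1 v1 v2 =
           quad_area V u v u1 u2 v0 v1 / quad_area V u v u1 u2 v1 v2"
    by (elim exE conjE) (rule that; assumption)
  define g where "g = the_inv_into V (\<lambda>q. (u q, v q))"
  have bij: "bij_betw (\<lambda>q. (u q, v q)) V (K \<times> L)" and g_cont: "continuous_on (K \<times> L) g"
    using diffeo smooth_onD(3) by (auto simp: diffeomorphism_between_def g_def)
  have uv: "u q \<in> K" "v q \<in> L" "g (u q, v q) = q" if "q \<in> V" for q
    using bij that the_inv_into_f_f[of "\<lambda>q. (u q, v q)" V q] by (auto simp: bij_betw_def g_def)
  have g: "g (a, b) \<in> V" "u (g (a, b)) = a" "v (g (a, b)) = b" if "a \<in> K" "b \<in> L" for a b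
    using bij_betw_the_inv_into[OF bij] f_the_inv_into_f_bij_betw[OF bij, of "(a, b)"] that
    by (auto simp: g_def bij_betw_def)
  have conn_u: "connected {q \<in> V. u q = a}" if "a \<in> K" for a
  proof -
    have "{q \<in> V. u q = a} = (\<lambda>b. g (a, b)) ` L"
      using g[OF that] uv by (force simp: image_iff)
    moreover have "continuous_on L (\<lambda>b. g (a, b))"
      using that by (intro continuous_on_compose2[OF g_cont] continuous_intros) auto
    ultimately show ?thesis
      using KL(4) by (simp add: is_interval_connected_1 connected_continuous_image)
  qed
  have conn_v: "connected {q \<in> V. v q = b}" if "b \<in> L" for b
  proof -
    have "{q \<in> V. v q = b} = (\<lambda>a. g (a, b)) ` K"
      using g[OF _ that] uv by (force simp: image_iff)
    moreover have "continuous_on K (\<lambda>a. g (a, b))"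
      using that by (intro continuous_on_compose2[OF g_cont] continuous_intros) auto
    ultimately show ?thesis
      using KL(2) by (simp add: is_interval_connected_1 connected_continuous_image)
  qed
  \<comment> \<open>The level sets of \<open>u\<close> and \<open>v\<close> in \<open>V\<close> are
    connected, so \<open>r\<close> depends on \<open>u\<close> alone and \<open>s\<close> on
    \<open>v\<close> alone; both functions are defined by their values on the coordinate curves
    through \<open>p\<close>.\<close>
  define \<phi> where "\<phi> a = fst (\<Phi> (g (a, v p)))" for a
  define \<psi> where "\<psi> b = snd (\<Phi> (g (u p, b)))" for b
  note p_KL = uv(1,2)[OF V(2)]
  have \<Phi>_g: "\<Phi> (g (a, b)) = (\<phi> a, \<psi> b)" if "a \<in> K" "b \<in> L" for a b
  proof -
    have "fst (\<Phi> (g (a, b))) = \<phi> a"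
      unfolding \<phi>_def using first_integral_level[OF fi(1) conn_u[OF that(1)]] g that p_KL by simp
    moreover have "snd (\<Phi> (g (a, b))) = \<psi> b"
      unfolding \<psi>_def using first_integral_level[OF fi(2) conn_v[OF that(2)]] g that p_KL by simp
    ultimately show ?thesis
      by (simp add: prod_eq_iff)
  qed
  have g_\<Psi>: "g (a, b) = \<Psi> (\<phi> a, \<psi> b)" "(\<phi> a, \<psi> b) \<in> C" if "a \<in> K" "b \<in> L" for a b
  proof -
    have "g (a, b) \<in> M"
      using g(1)[OF that] V(3) by auto
    then show "g (a, b) = \<Psi> (\<phi> a, \<psi> b)" "(\<phi> a, \<psi> b) \<in> C"
      using \<Psi>_\<Phi>[of "g (a, b)"] \<Phi>_mem[of "g (a, b)"] unfolding \<Phi>_g[OF that] by auto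
  qed
  have inj: "inj_on \<phi> K" "inj_on \<psi> L"
  proof -
    show "inj_on \<phi> K"
      using g_\<Psi>(1)[OF _ p_KL(2)] g(2)[OF _ p_KL(2)] by (metis inj_onI)
    show "inj_on \<psi> L"
      using g_\<Psi>(1)[OF p_KL(1)] g(3)[OF p_KL(1)] by (metis inj_onI)
  qed
  have "g ` (K \<times> L) \<subseteq> V"
    using g(1) by auto
  from continuous_on_compose2[OF continuous_on_subset[OF continuous_on_\<Phi> V(3)] g_cont this]
  have \<Phi>g_cont: "continuous_on (K \<times> L) (\<lambda>x. \<Phi> (g x))" .
  have "continuous_on K (\<lambda>a. \<Phi> (g (a, v p)))" "continuous_on L (\<lambda>b. \<Phi> (g (u p, b)))"
    using p_KL by (auto intro!: continuous_on_compose2[OF \<Phi>g_cont] continuous_on_Pair continuous_on_const continuous_on_id)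
  then have cont: "continuous_on K \<phi>" "continuous_on L \<psi>"
    unfolding \<phi>_def \<psi>_def by (auto intro: continuous_on_fst continuous_on_snd)
  have quad: "quad_area V u v u0 u1 v0 v1 = measure lborel (\<Psi> ` (\<phi> ` {u0<..<u1} \<times> \<psi> ` {v0<..<v1}))"
    if "u0 \<in> K" "u1 \<in> K" "v0 \<in> L" "v1 \<in> L" for u0 u1 v0 v1
  proof -
    have sub: "{u0<..<u1} \<subseteq> K" "{v0<..<v1} \<subseteq> L"
      using mem_is_interval_1_I[OF KL(2) that(1,2)] mem_is_interval_1_I[OF KL(4) that(3,4)] by auto
    have "{q \<in> V. u0 < u q \<and> u q < u1 \<and> v0 < v q \<and> v q < v1} = g ` ({u0<..<u1} \<times> {v0<..<v1})"
    proof (intro set_eqI iffI)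
      fix q assume "q \<in> {q \<in> V. u0 < u q \<and> u q < u1 \<and> v0 < v q \<and> v q < v1}"
      then show "q \<in> g ` ({u0<..<u1} \<times> {v0<..<v1})"
        using uv(3)[of q] by (intro image_eqI[of _ _ "(u q, v q)"]) auto
    next
      fix q assume "q \<in> g ` ({u0<..<u1} \<times> {v0<..<v1})"
      then show "q \<in> {q \<in> V. u0 < u q \<and> u q < u1 \<and> v0 < v q \<and> v q < v1}"
      proof
        fix x assume x: "x \<in> {u0<..<u1} \<times> {v0<..<v1}" "q = g x"
        then have "fst x \<in> K" "snd x \<in> L"
          using sub by auto
        from g[OF this] x show ?thesis
          by auto
      qed
    qed
    also have "\<dots> = (\<lambda>(a, b). \<Psi> (\<phi> a, \<psi> b)) ` ({u0<..<u1} \<times> {v0<..<v1})"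
      using g_\<Psi>(1) sub by (intro image_cong) auto
    also have "\<dots> = \<Psi> ` (\<phi> ` {u0<..<u1} \<times> \<psi> ` {v0<..<v1})"
      by (simp add: image_paired_Times[symmetric] image_image case_prod_unfold)
    finally show ?thesis
      by (simp add: quad_area_def)
  qed
  show ?thesis
  proof (rule that[of "\<phi> ` K" "\<psi> ` L"])
    show "is_interval (\<phi> ` K)" "is_interval (\<psi> ` L)"
      using KL cont by (auto simp: is_interval_connected_1 intro: connected_continuous_image)
    show "open (\<phi> ` K)" "open (\<psi> ` L)"
      using KL cont inj by (auto intro: invariance_of_domain)
    have "(r, s) = (\<phi> (u p), \<psi> (v p))"
      using \<Phi>_g[OF p_KL] uv(3)[OF V(2)] assms(2) by (simp add: p_def)
    then show "r \<in> \<phi> ` K" "s \<in> \<psi> ` L"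
      using p_KL by auto
    show "\<phi> ` K \<times> \<psi> ` L \<subseteq> C"
      using g_\<Psi>(2) by auto
    fix a0 a1 a2 b0 b1 b2
    assume ab: "{a0, a1, a2} \<subseteq> \<phi> ` K" "{b0, b1, b2} \<subseteq> \<psi> ` L" "a0 < a1" "a1 < a2" "b0 < b1" "b1 < b2"
    obtain x0 x1 x2 where x: "{x0, x1, x2} \<subseteq> K" "x0 < x1" "x1 < x2"
      and xa: "\<phi> ` {x0<..<x1} = {a0<..<a1} \<and> \<phi> ` {x1<..<x2} = {a1<..<a2} \<or>
       \<phi> ` {x0<..<x1} = {a1<..<a2} \<and> \<phi> ` {x1<..<x2} = {a0<..<a1}"
      using adjacent_interval_preimages[OF cont(1) inj(1) KL(2) ab(1,3,4)] .
    obtain y0 y1 y2 where y: "{y0, y1, y2} \<subseteq> L" "y0 < y1" "y1 < y2"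
      and yb: "\<psi> ` {y0<..<y1} = {b0<..<b1} \<and> \<psi> ` {y1<..<y2} = {b1<..<b2} \<or>
       \<psi> ` {y0<..<y1} = {b1<..<b2} \<and> \<psi> ` {y1<..<y2} = {b0<..<b1}"
      using adjacent_interval_preimages[OF cont(2) inj(2) KL(4) ab(2,5,6)] .
    have eq: "quad_area V u v x0 x1 y0 y1 / quad_area V u v x0 x1 y1 y2 =
           quad_area V u v x1 x2 y0 y1 / quad_area V u v x1 x2 y1 y2"
      using sam x y by simp
    \<comment> \<open>If \<open>\<psi>\<close> is decreasing, numerators and denominators are
      exchanged; if \<open>\<phi>\<close> is decreasing, the two sides of the equation are.\<close>
    have swap: "i / j = k / l \<Longrightarrow> j / i = l / k" for i j k l :: real
      by (metis inverse_divide)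
    from eq xa yb show "patch_area a0 a1 b0 b1 / patch_area a0 a1 b1 b2 = patch_area a1 a2 b0 b1 / patch_area a1 a2 b1 b2"
      using x(1) y(1) by (auto simp: quad patch_area_def dest: swap)
  qed
qed

end

text \<open>Local vanishing of mixed differences makes the first partial derivative locally constant in the
  second variable.\<close>

lemma mixed_difference_local_to_global:
  fixes F :: "real \<Rightarrow> real \<Rightarrow> real"
  assumes AB: "is_interval A" "is_interval B"
    and diff: "\<And>a b. a \<in> A \<Longrightarrow> b \<in> B \<Longrightarrow> (\<lambda>x. F x b) field_differentiable (at a)"
    and local: "\<And>a b. a \<in> A \<Longrightarrow> b \<in> B \<Longrightarrow> \<exists>U W. open U \<and> a \<in> U \<and> open W \<and> b \<in> W \<and>
      (\<forall>x\<in>U. \<forall>y\<in>W. F x y + F a b = F x b + F a y)"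
    and mem: "x \<in> A" "x' \<in> A" "y \<in> B" "y' \<in> B"
  shows "F x y + F x' y' = F x y' + F x' y"
proof -
  have D: "((\<lambda>x. F x b) has_field_derivative deriv (\<lambda>x. F x b) a) (at a)" if "a \<in> A" "b \<in> B" for a b
    using diff[OF that] by (simp add: DERIV_deriv_iff_field_differentiable)
  have deriv_eq: "deriv (\<lambda>x. F x y) a = deriv (\<lambda>x. F x y') a" if "a \<in> A" for a
  proof (rule connected_local_const[of B y y' "\<lambda>b. deriv (\<lambda>x. F x b) a"])
    show "connected B"
      using AB(2) by (simp add: is_interval_connected_1)
    show "\<forall>b\<in>B. \<forall>\<^sub>F z in at b within B. deriv (\<lambda>x. F x b) a = deriv (\<lambda>x. F x z) a"
    proof
      fix b assume "b \<in> B"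
      then obtain U W where UW: "open U" "a \<in> U" "open W" "b \<in> W"
        and eq: "\<And>x z. x \<in> U \<Longrightarrow> z \<in> W \<Longrightarrow> F x z + F a b = F x b + F a z"
        using local[OF \<open>a \<in> A\<close> \<open>b \<in> B\<close>] by blast
      have "deriv (\<lambda>x. F x b) a = deriv (\<lambda>x. F x z) a" if "z \<in> W" for z
      proof -
        have "((\<lambda>x. F x z) has_field_derivative deriv (\<lambda>x. F x b) a) (at a)"
        proof (rule has_field_derivative_transform_within_open[OF _ UW(1,2)])
          show "((\<lambda>x. F x b + (F a z - F a b)) has_field_derivative deriv (\<lambda>x. F x b) a) (at a)"
            using D[OF \<open>a \<in> A\<close> \<open>b \<in> B\<close>] by (auto intro!: derivative_eq_intros)
          show "F x b + (F a z - F a b) = F x z" if "x \<in> U" for x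
            using eq[OF that \<open>z \<in> W\<close>] by simp
        qed
        then show ?thesis
          by (simp add: DERIV_imp_deriv)
      qed
      then show "\<forall>\<^sub>F z in at b within B. deriv (\<lambda>x. F x b) a = deriv (\<lambda>x. F x z) a"
        using UW(3,4) unfolding eventually_at_topological by blast
    qed
  qed (use mem in auto)
  have "((\<lambda>x. F x y - F x y') has_field_derivative 0) (at a within A)" if "a \<in> A" for a
    using DERIV_diff[OF D[OF that mem(3)] D[OF that mem(4)]] deriv_eq[OF that]
    by (auto intro: has_field_derivative_at_within)
  then obtain c where c: "\<forall>x\<in>A. F x y - F x y' = c"
    using has_field_derivative_zero_constant[of A "\<lambda>x. F x y - F x y'"] AB(1)
    by (auto simp: is_interval_convex)
  from bspec[OF c mem(1)] bspec[OF c mem(2)] show ?thesis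
    by linarith
qed

section \<open>Asymptotics at the diagonal and the contradiction\<close>

context tangent_chart
begin

text \<open>Writing \<open>d\<close> for the parameter difference, each \<open>gap\<close> has size
  about \<open>d^2 / 2\<close> times \<open>\<bar>\<kappa>\<bar>\<close> and \<open>turn\<close>
  about \<open>d\<close> times \<open>\<bar>\<kappa>\<bar>\<close>; hence the coupling factor is
  about \<open>d / (4 * \<bar>\<kappa>\<bar>)\<close>. The errors are collected in
  \<open>\<rho>\<close>.\<close>

lemma density_eq:
  assumes "(r, s) \<in> C"
  obtains \<rho> where "99 / 100 < \<rho>" "\<rho> < 101 / 100"
    "density (r, s) = \<bar>bend \<gamma> r r\<bar> * \<bar>bend \<gamma> s s\<bar> * (\<bar>s - r\<bar> * \<rho>) / (4 * \<bar>\<kappa>\<bar>)"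
proof -
  note rs = C_memD[OF assms]
  obtain a b where ab: "a \<in> J" "b \<in> J" "gap \<gamma> r s = - ((s - r)\<^sup>2 / 2 * bend \<gamma> a b)"
    using gap_eq[OF rs(1,2)] .
  obtain a' b' where ab': "a' \<in> J" "b' \<in> J" "gap \<gamma> s r = - ((r - s)\<^sup>2 / 2 * bend \<gamma> a' b')"
    using gap_eq[OF rs(2,1)] .
  obtain c where c: "c \<in> J" "turn \<gamma> s r = (r - s) * bend \<gamma> s c"
    using turn_eq[OF rs(2,1)] .
  define \<beta> \<beta>' \<beta>'' where "\<beta> = bend \<gamma> a b / \<kappa>" and "\<beta>' = bend \<gamma> a' b' / \<kappa>" and "\<beta>'' = bend \<gamma> s c / \<kappa>"
  define \<rho> where "\<rho> = \<beta> * \<beta>' / \<beta>'' ^ 3"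
  have \<kappa>: "\<kappa> \<noteq> 0"
    using bend_bounds(1)[OF rs(1,2)] .
  have \<beta>: "999 / 1000 < \<beta>" "\<beta> < 1001 / 1000" "999 / 1000 < \<beta>'" "\<beta>' < 1001 / 1000"
    "999 / 1000 < \<beta>''" "\<beta>'' < 1001 / 1000"
    unfolding \<beta>_def \<beta>'_def \<beta>''_def using bend_bounds ab ab' rs c by blast+
  have prod: "(999 / 1000) * (999 / 1000) < \<beta> * \<beta>'" "\<beta> * \<beta>' < (1001 / 1000) * (1001 / 1000)"
    using \<beta> by (intro mult_strict_mono; simp)+
  have cube: "(999 / 1000) ^ 3 < \<beta>'' ^ 3" "\<beta>'' ^ 3 < (1001 / 1000) ^ 3"
    using \<beta> by (intro power_strict_mono; simp)+
  have "0 < \<beta>'' ^ 3"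
    using \<beta> by simp
  \<comment> \<open>Numerically, \<open>0.999^2 / 1.001^3 > 0.99\<close> and
    \<open>1.001^2 / 0.999^3 < 1.01\<close>.\<close>
  then have "99 / 100 < \<rho>" "\<rho> < 101 / 100"
    unfolding \<rho>_def using prod cube by (simp_all add: pos_less_divide_eq pos_divide_less_eq power3_eq_cube)
  moreover have "density (r, s) = \<bar>bend \<gamma> r r\<bar> * \<bar>bend \<gamma> s s\<bar> * (\<bar>s - r\<bar> * \<rho>) / (4 * \<bar>\<kappa>\<bar>)"
  proof -
    define d where "d = \<bar>s - r\<bar>"
    have d: "0 < d" "(s - r)\<^sup>2 = d\<^sup>2" "(r - s)\<^sup>2 = d\<^sup>2" "\<bar>r - s\<bar> = d"
      using rs(3) by (auto simp: d_def power2_commute)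
    define k where "k = \<bar>\<kappa>\<bar>"
    have k: "0 < k"
      using \<kappa> by (simp add: k_def)
    have "bend \<gamma> a b = \<beta> * \<kappa>" "bend \<gamma> a' b' = \<beta>' * \<kappa>" "bend \<gamma> s c = \<beta>'' * \<kappa>"
      using \<kappa> by (simp_all add: \<beta>_def \<beta>'_def \<beta>''_def)
    then have "\<bar>gap \<gamma> r s\<bar> = d\<^sup>2 / 2 * (\<beta> * k)" "\<bar>gap \<gamma> s r\<bar> = d\<^sup>2 / 2 * (\<beta>' * k)"
      "\<bar>turn \<gamma> s r\<bar> = d * (\<beta>'' * k)"
      unfolding ab(3) ab'(3) c(2) d(2,3) k_def using \<beta> d(4) by (simp_all add: abs_mult)
    then have "\<bar>gap \<gamma> r s * gap \<gamma> s r / turn \<gamma> s r ^ 3\<bar> =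
        (d\<^sup>2 / 2 * (\<beta> * k)) * (d\<^sup>2 / 2 * (\<beta>' * k)) / (d * (\<beta>'' * k)) ^ 3"
      by (simp only: abs_mult abs_divide power_abs)
    also have "\<dots> = d * \<rho> / (4 * k)"
      using \<beta>(5) d(1) k unfolding \<rho>_def by (simp add: field_simps power2_eq_square power3_eq_cube)
    finally have "\<bar>gap \<gamma> r s * gap \<gamma> s r / turn \<gamma> s r ^ 3\<bar> = d * \<rho> / (4 * \<bar>\<kappa>\<bar>)"
      by (simp only: k_def)
    moreover have "density (r, s) = \<bar>bend \<gamma> r r\<bar> * \<bar>bend \<gamma> s s\<bar> * \<bar>gap \<gamma> r s * gap \<gamma> s r / turn \<gamma> s r ^ 3\<bar>"
      by (simp only: density_def omega_d\<Psi>_d\<Psi>[OF assms] abs_mult)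
    ultimately show ?thesis
      by (simp only: d_def times_divide_eq_right)
  qed
  ultimately show ?thesis
    using that by blast
qed

lemma density_pos: "x \<in> C \<Longrightarrow> 0 < density x"
proof (cases x)
  case (Pair r s)
  assume "x \<in> C"
  then have C: "(r, s) \<in> C"
    using Pair by simp
  obtain \<rho> where "99 / 100 < \<rho>"
    "density (r, s) = \<bar>bend \<gamma> r r\<bar> * \<bar>bend \<gamma> s s\<bar> * (\<bar>s - r\<bar> * \<rho>) / (4 * \<bar>\<kappa>\<bar>)"
    using density_eq[OF C] .
  moreover note rs = C_memD[OF C]
  moreover have "\<kappa> \<noteq> 0" "bend \<gamma> r r \<noteq> 0" "bend \<gamma> s s \<noteq> 0"
    using bend_bounds(1,4) rs by blast+
  ultimately show ?thesis
    by (simp add: Pair)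
qed

text \<open>After taking logarithms the identity says that a mixed difference vanishes, and such a
  statement passes from small rectangles to large ones by
  \<open>mixed_difference_local_to_global\<close>.\<close>

lemma density_exchange:
  assumes sam: "samuelson M (tangent_web \<gamma> C)"
    and AB: "is_interval A" "is_interval B" "A \<times> B \<subseteq> C"
    and mem: "x \<in> A" "x' \<in> A" "y \<in> B" "y' \<in> B"
  shows "density (x, y) * density (x', y') = density (x, y') * density (x', y)"
proof -
  define D where "D z = omega (d\<Psi> z (1, 0)) (d\<Psi> z (0, 1))" for z
  \<comment> \<open>Squaring the signed Jacobian gives a smooth positive function without any
    discussion of signs; its logarithm is twice that of the density.\<close>
  define F where "F x y = ln ((D (x, y))\<^sup>2)" for x y
  have D_density: "(D z)\<^sup>2 = (density z)\<^sup>2" for z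
    by (simp add: D_def density_def)
  have F_eq: "F x y = 2 * ln (density (x, y))" if "(x, y) \<in> C" for x y
    using density_pos[OF that] by (simp add: F_def D_density ln_realpow)
  have "F x y + F x' y' = F x y' + F x' y"
  proof (rule mixed_difference_local_to_global[OF AB(1,2) _ _ mem])
    fix a b assume "a \<in> A" "b \<in> B"
    then have ab: "(a, b) \<in> C"
      using AB(3) by auto
    have "smooth_on C D"
      unfolding D_def d\<Psi>_def
      by (intro smooth_on_bilinear[OF bounded_bilinear_omega] smooth_onD(5) smooth_on_tangent_intersection)
    from smooth_onD(4)[OF this ab] have "D differentiable (at (a, b))"
      by (auto simp: differentiable_def)
    moreover have "((\<lambda>x. (x, b)) has_derivative (\<lambda>h. (h, 0))) (at a)"
      by (auto intro!: derivative_eq_intros)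
    ultimately have "(\<lambda>x. D (x, b)) differentiable (at a)"
      using differentiable_compose[of D "\<lambda>x. (x, b)" a UNIV] by (auto simp: differentiable_def)
    then obtain D' where "((\<lambda>x. D (x, b)) has_field_derivative D') (at a)"
      by (auto simp: real_differentiable_def)
    moreover have "0 < (D (a, b))\<^sup>2"
      using density_pos[OF ab] by (simp add: D_density)
    ultimately show "(\<lambda>x. F x b) field_differentiable (at a)"
      unfolding F_def field_differentiable_def by (auto intro!: exI derivative_eq_intros)
    obtain U W where UW: "is_interval U" "open U" "a \<in> U" "is_interval W" "open W" "b \<in> W" "U \<times> W \<subseteq> C"
      and ratio: "\<And>a0 a1 a2 b0 b1 b2. {a0, a1, a2} \<subseteq> U \<Longrightarrow> {b0, b1, b2} \<subseteq> W \<Longrightarrow>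
      a0 < a1 \<Longrightarrow> a1 < a2 \<Longrightarrow> b0 < b1 \<Longrightarrow> b1 < b2 \<Longrightarrow>
      patch_area a0 a1 b0 b1 / patch_area a0 a1 b1 b2 = patch_area a1 a2 b0 b1 / patch_area a1 a2 b1 b2"
      using samuelson_rectangle[OF sam ab] by blast
    note strict = density_exchange_strict[OF UW(1,2,4,5,7) ratio]
    have exch: "density (x, y) * density (a, b) = density (x, b) * density (a, y)" if "x \<in> U" "y \<in> W" for x y
    proof -
      \<comment> \<open>The strict version needs both coordinates to differ and to be ordered. The
        identity is trivial if one of them agrees, and it is symmetric under exchanging the two
        values of either coordinate.\<close>
      consider "x = a" | "y = b" | "x < a" "y < b" | "x < a" "b < y" | "a < x" "y < b" | "a < x" "b < y"
        by linarith
      then show ?thesis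
      proof cases
        case 3
        then show ?thesis using strict[of x a y b] that UW by auto
      next
        case 4
        then show ?thesis using strict[of x a b y] that UW by auto
      next
        case 5
        then show ?thesis using strict[of a x y b] that UW by (simp add: mult.commute)
      next
        case 6
        then show ?thesis using strict[of a x b y] that UW by (simp add: mult.commute)
      qed auto
    qed
    have "F x y + F a b = F x b + F a y" if "x \<in> U" "y \<in> W" for x y
    proof -
      have C: "(x, y) \<in> C" "(a, b) \<in> C" "(x, b) \<in> C" "(a, y) \<in> C"
        using that UW by auto
      show ?thesis
        using arg_cong[OF exch[OF that], of ln] C[THEN density_pos] by (simp add: C[THEN F_eq] ln_mult_pos)
    qed
    then show "\<exists>U W. open U \<and> a \<in> U \<and> open W \<and> b \<in> W \<and> (\<forall>x\<in>U. \<forall>y\<in>W. F x y + F a b = F x b + F a y)"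
      using UW by blast
  qed
  moreover have C: "(x, y) \<in> C" "(x', y') \<in> C" "(x, y') \<in> C" "(x', y) \<in> C"
    using mem AB(3) by auto
  ultimately have "ln (density (x, y) * density (x', y')) = ln (density (x, y') * density (x', y))"
    using C[THEN density_pos] by (simp add: C[THEN F_eq] ln_mult_pos)
  then show ?thesis
    using C[THEN density_pos] by simp
qed

text \<open>Near the diagonal the density is close to a constant times \<open>\<bar>s - r\<bar>\<close>, and \<open>3 * 3 \<noteq> 4 * 2\<close>.\<close>

lemma not_samuelson:
  assumes AB: "is_interval A" "is_interval B" "A \<times> B \<subseteq> C"
    and mem: "a \<in> A" "a' \<in> A" "b \<in> B" "b' \<in> B"
    and h: "0 < h" "\<bar>b - a\<bar> = 3 * h" "\<bar>b' - a'\<bar> = 3 * h" "\<bar>b' - a\<bar> * \<bar>b - a'\<bar> = 8 * h\<^sup>2"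
  shows "\<not> samuelson M (tangent_web \<gamma> C)"
proof
  assume "samuelson M (tangent_web \<gamma> C)"
  note exch = density_exchange[OF this AB mem]
  have C: "(a, b) \<in> C" "(a', b') \<in> C" "(a, b') \<in> C" "(a', b) \<in> C"
    using mem AB(3) by auto
  note J = C[THEN C_memD(1)] C[THEN C_memD(2)]
  obtain \<rho>1 where 1: "99 / 100 < \<rho>1" "\<rho>1 < 101 / 100"
    "density (a, b) = \<bar>bend \<gamma> a a\<bar> * \<bar>bend \<gamma> b b\<bar> * (\<bar>b - a\<bar> * \<rho>1) / (4 * \<bar>\<kappa>\<bar>)"
    using density_eq[OF C(1)] .
  obtain \<rho>2 where 2: "99 / 100 < \<rho>2" "\<rho>2 < 101 / 100"
    "density (a', b') = \<bar>bend \<gamma> a' a'\<bar> * \<bar>bend \<gamma> b' b'\<bar> * (\<bar>b' - a'\<bar> * \<rho>2) / (4 * \<bar>\<kappa>\<bar>)"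
    using density_eq[OF C(2)] .
  obtain \<rho>3 where 3: "99 / 100 < \<rho>3" "\<rho>3 < 101 / 100"
    "density (a, b') = \<bar>bend \<gamma> a a\<bar> * \<bar>bend \<gamma> b' b'\<bar> * (\<bar>b' - a\<bar> * \<rho>3) / (4 * \<bar>\<kappa>\<bar>)"
    using density_eq[OF C(3)] .
  obtain \<rho>4 where 4: "99 / 100 < \<rho>4" "\<rho>4 < 101 / 100"
    "density (a', b) = \<bar>bend \<gamma> a' a'\<bar> * \<bar>bend \<gamma> b b\<bar> * (\<bar>b - a'\<bar> * \<rho>4) / (4 * \<bar>\<kappa>\<bar>)"
    using density_eq[OF C(4)] .
  \<comment> \<open>Each of the four parameters contributes its own \<open>bend\<close> once to both
    products of densities, so \<open>k\<close> is common to them.\<close>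
  define k where "k = \<bar>bend \<gamma> a a\<bar> * \<bar>bend \<gamma> b b\<bar> * \<bar>bend \<gamma> a' a'\<bar> * \<bar>bend \<gamma> b' b'\<bar> / (4 * \<bar>\<kappa>\<bar>)\<^sup>2"
  have "k \<noteq> 0"
    unfolding k_def using bend_bounds(1)[OF J(1,1)] bend_bounds(4)[OF J(1,1)] bend_bounds(4)[OF J(2,2)]
      bend_bounds(4)[OF J(5,5)] bend_bounds(4)[OF J(6,6)] by simp
  moreover have "density (a, b) * density (a', b') = k * ((3 * h) * (3 * h) * (\<rho>1 * \<rho>2))"
    unfolding 1 2 h k_def by (simp add: power2_eq_square)
  moreover have "density (a, b') * density (a', b) = k * ((\<bar>b' - a\<bar> * \<bar>b - a'\<bar>) * (\<rho>3 * \<rho>4))"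
    unfolding 3 4 k_def by (simp add: power2_eq_square)
  ultimately have "(3 * h) * (3 * h) * (\<rho>1 * \<rho>2) = 8 * h\<^sup>2 * (\<rho>3 * \<rho>4)"
    using exch unfolding h(4) by simp
  then have "9 * (\<rho>1 * \<rho>2) = 8 * (\<rho>3 * \<rho>4)"
    using h(1) by (simp add: power2_eq_square)
  \<comment> \<open>The left side is thus above \<open>9 * 0.9801 = 8.8209\<close>, the right side
    below \<open>8 * 1.0201 = 8.1608\<close>.\<close>
  moreover have "(99 / 100) * (99 / 100) < \<rho>1 * \<rho>2" "\<rho>3 * \<rho>4 < (101 / 100) * (101 / 100)"
    using 1(1,2) 2(1,2) 3(1,2) 4(1,2) by (intro mult_strict_mono; simp)+
  ultimately show False
    by simp
qed

end

text \<open>The ratio of \<open>bend\<close> to its reference value is jointly continuous in both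
  parameters and equals 1 at \<open>(r0, r0)\<close>, so the tolerance holds on a square around that
  point.\<close>

lemma convex_arc_near:
  fixes \<gamma> :: "real \<Rightarrow> plane"
  assumes "smooth_on I \<gamma>" "r0 \<in> I" "bend \<gamma> r0 r0 \<noteq> 0"
  obtains J where "r0 \<in> J" "J \<subseteq> I" "convex_arc \<gamma> J (bend \<gamma> r0 r0)"
proof -
  let ?\<kappa> = "bend \<gamma> r0 r0"
  note opn = smooth_onD(1)[OF assms(1)]
  note v = smooth_on_velocity(2)[OF assms(1)]
  have a: "smooth_on I (accel \<gamma>)"
    using smooth_on_velocity(2)[OF v] by (simp add: velocity_def[abs_def])
  let ?f = "\<lambda>x. bend \<gamma> (fst x) (snd x) / ?\<kappa> - 1"
  have "continuous_on (I \<times> I) ?f"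
    unfolding bend_def using assms(3)
    by (intro continuous_intros omega.continuous_on continuous_on_compose2[OF smooth_onD(3)[OF v]]
        continuous_on_compose2[OF smooth_onD(3)[OF a]]) (auto simp: bend_def)
  then have "isCont ?f (r0, r0)"
    using assms(2) opn by (auto simp: continuous_on_eq_continuous_at open_Times)
  then have "\<forall>\<^sub>F x in nhds (r0, r0). dist (?f x) (?f (r0, r0)) < 1 / 1000"
    unfolding isCont_def tendsto_at_iff_tendsto_nhds[of ?f "(r0, r0)"] by (rule tendstoD) simp
  moreover have "\<forall>\<^sub>F x in nhds (r0, r0). x \<in> I \<times> I"
    using assms(2) opn by (intro eventually_nhds_in_open) (auto simp: open_Times)
  ultimately have "\<forall>\<^sub>F x in nhds (r0, r0). dist (?f x) (?f (r0, r0)) < 1 / 1000 \<and> x \<in> I \<times> I"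
    by (rule eventually_conj)
  then obtain \<delta> where \<delta>: "0 < \<delta>"
    "\<And>x. dist x (r0, r0) < \<delta> \<Longrightarrow> dist (?f x) (?f (r0, r0)) < 1 / 1000 \<and> x \<in> I \<times> I"
    by (auto simp: eventually_nhds_metric)
  let ?J = "ball r0 (\<delta> / 2)"
  have near: "dist (r, s) (r0, r0) < \<delta>" if "r \<in> ?J" "s \<in> ?J" for r s
  proof -
    have "dist (r, s) (r0, r0) \<le> \<bar>r - r0\<bar> + \<bar>s - r0\<bar>"
      by (simp add: dist_Pair_Pair dist_real_def sqrt_sum_squares_le_sum_abs)
    also have "\<dots> < \<delta>"
      using that by (simp add: dist_real_def abs_minus_commute)
    finally show ?thesis .
  qed
  have "?J \<subseteq> I"
    using \<delta>(2)[OF near] by auto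
  moreover have "convex_arc \<gamma> ?J ?\<kappa>"
  proof
    show "smooth_on ?J \<gamma>"
      by (rule smooth_on_subset[OF assms(1) open_ball \<open>?J \<subseteq> I\<close>])
    show "is_interval ?J"
      by (simp add: is_interval_convex_1)
    show "\<bar>bend \<gamma> r s / ?\<kappa> - 1\<bar> < 1 / 1000" if "r \<in> ?J" "s \<in> ?J" for r s
      using \<delta>(2)[OF near[OF that]] assms(3) by (simp add: dist_real_def)
  qed simp
  ultimately show ?thesis
    using that[of ?J] \<delta>(1) by simp
qed

theorem theorem4p1:
  fixes \<gamma> :: "real \<Rightarrow> real \<times> real" and I :: "real set" and r0 :: real
  assumes "open I" and "is_interval I"
    and "smooth_on I \<gamma>"
    and "\<And>r. r \<in> I \<Longrightarrow> velocity \<gamma> r \<noteq> 0"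
    and "r0 \<in> I" and "curvature \<gamma> r0 \<noteq> 0"
  shows "\<exists>W. open W \<and> (r0, r0) \<in> W \<and> W \<subseteq> I \<times> I \<and>
    (\<forall>N C. open N \<and> (r0, r0) \<in> N \<and> N \<subseteq> W \<and>
       components (N - {(r, r) | r. r \<in> I}) =
         {N \<inter> {(r, s). r < s}, N \<inter> {(r, s). r > s}} \<and>
       (C = N \<inter> {(r, s). r < s} \<or> C = N \<inter> {(r, s). r > s}) \<longrightarrow>
       (\<forall>(r, s)\<in>C. \<not> parallel_tangents \<gamma> r s) \<and>
       diffeomorphism_between C (tangent_intersection \<gamma> ` C) (tangent_intersection \<gamma>) \<and>
       lagrangian_2_web (tangent_intersection \<gamma> ` C) (tangent_web \<gamma> C) \<and>
       \<not> samuelson (tangent_intersection \<gamma> ` C) (tangent_web \<gamma> C))"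
proof -
  have "bend \<gamma> r0 r0 \<noteq> 0"
    using assms(6) by (auto simp: curvature_def bend_def)
  with assms(3,5) obtain J where J: "r0 \<in> J" "J \<subseteq> I" "convex_arc \<gamma> J (bend \<gamma> r0 r0)"
    by (rule convex_arc_near)
  interpret convex_arc \<gamma> J "bend \<gamma> r0 r0"
    by (rule J(3))
  have main: "(\<forall>(r, s)\<in>C. \<not> parallel_tangents \<gamma> r s) \<and> diffeomorphism_between C (\<Psi> ` C) \<Psi> \<and>
      lagrangian_2_web (\<Psi> ` C) (tangent_web \<gamma> C) \<and> \<not> samuelson (\<Psi> ` C) (tangent_web \<gamma> C)"
    if N: "open N" "(r0, r0) \<in> N" "N \<subseteq> J \<times> J"
      and C: "C = N \<inter> {(r, s). r < s} \<or> C = N \<inter> {(r, s). r > s}" for N C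
  proof -
    have "open {(r, s). r < (s :: real)}" "open {(r, s). r > (s :: real)}"
      by (auto simp: case_prod_unfold intro!: open_Collect_less continuous_intros)
    with N(1) C have "open C"
      by auto
    then interpret tangent_chart \<gamma> J "bend \<gamma> r0 r0" C
      using N(3) C by unfold_locales auto
    have "\<not> parallel_tangents \<gamma> r s" if "(r, s) \<in> C" for r s
      using turn_nonzero[OF C_memD[OF that]] by (simp add: parallel_tangents_def turn_def)
    moreover have "\<not> samuelson (\<Psi> ` C) (tangent_web \<gamma> C)"
    proof -
      obtain \<delta> where \<delta>: "0 < \<delta>" "\<And>x. dist x (r0, r0) < \<delta> \<Longrightarrow> x \<in> N"
        using N(1,2) by (auto simp: open_dist)
      \<comment> \<open>Both coordinates of a test point differ from \<open>r0\<close> by at most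
        \<open>2 * h\<close>, so its distance from \<open>(r0, r0)\<close> is at most
        \<open>4 * h < \<delta>\<close>.\<close>
      define h where "h = \<delta> / 5"
      let ?A = "{r0 - 2 * h..r0 - h}" and ?B = "{r0 + h..r0 + 2 * h}"
      have "0 < h"
        using \<delta>(1) by (simp add: h_def)
      have near: "(r, s) \<in> N" if "\<bar>r - r0\<bar> \<le> 2 * h" "\<bar>s - r0\<bar> \<le> 2 * h" for r s
      proof (rule \<delta>(2))
        have "dist (r, s) (r0, r0) \<le> \<bar>r - r0\<bar> + \<bar>s - r0\<bar>"
          by (simp add: dist_Pair_Pair dist_real_def sqrt_sum_squares_le_sum_abs)
        also have "\<dots> < \<delta>"
          using that \<open>0 < h\<close> by (simp add: h_def)
        finally show "dist (r, s) (r0, r0) < \<delta>" .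
      qed
      from C show ?thesis
      proof
        assume "C = N \<inter> {(r, s). r < s}"
        then have "?A \<times> ?B \<subseteq> C"
          using near \<open>0 < h\<close> by (auto simp: abs_if)
        then show ?thesis
          by (intro not_samuelson[of ?A ?B "r0 - 2 * h" "r0 - h" "r0 + h" "r0 + 2 * h" h])
            (use \<open>0 < h\<close> in \<open>auto simp: is_interval_cc power2_eq_square abs_if\<close>)
      next
        assume "C = N \<inter> {(r, s). r > s}"
        \<comment> \<open>The reflection of the test points about \<open>r0\<close> lies on the
          other side of the diagonal and has the same parameter distances.\<close>
        then have "?B \<times> ?A \<subseteq> C"
          using near \<open>0 < h\<close> by (auto simp: abs_if)
        then show ?thesis
          by (intro not_samuelson[of ?B ?A "r0 + 2 * h" "r0 + h" "r0 - h" "r0 - 2 * h" h])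
            (use \<open>0 < h\<close> in \<open>auto simp: is_interval_cc power2_eq_square abs_if\<close>)
      qed
    qed
    ultimately show ?thesis
      using diffeomorphism_\<Psi> lagrangian_2_web_tangent_web by blast
  qed
  show ?thesis
  \<comment> \<open>A single \<open>W\<close> serves every \<open>N\<close>: the bounds on
    \<open>bend\<close> hold on all of \<open>J \<times> J\<close>, and the test rectangle shrinks
    with \<open>N\<close>.\<close>
  proof (intro exI[of _ "J \<times> J"] conjI)
    show "open (J \<times> J)"
      by (intro open_Times open_J)
    show "(r0, r0) \<in> J \<times> J" "J \<times> J \<subseteq> I \<times> I"
      using J(1,2) by auto
  qed (intro allI impI, elim conjE, rule main, assumption+)
qed

end
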